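(* Let $d\ge 1$ be an integer, and let $M=\{(t,x)\in\mathbb{R}_+\times\mathbb{R}^{d+1} : |x|=f(t)\}$ be a spherically symmetric time-like hypersurface of constant mean curvature $d+1$ in Minkowski space $\mathbb{R}^{1,d+1}$ whose defining function $f:\mathbb{R}_+\to\mathbb{R}_+$ satisfies $\lim_{t\to\infty}f(t)=\infty$; equivalently, $f$ is a positive $C^2$ solution with $|f'|<1$ of $$[1-(f')^2]\,d+f f''=(d+1)[1-(f')^2]^{3/2}f .$$ Fix a time $t_0>0$. Then, with respect to perturbations within the class of spherically symmetric solutions: (1) $f$ is future asymptotically unstable as an individual solution: in every neighbourhood of the data $(f(t_0),f'(t_0))$ in $\mathbb{R}_+\times(-1,1)$ there is data whose corresponding solution $\tilde f$ of the same equation does not satisfy $\lim_{t\to\infty}|\tilde f(t)-f(t)|=0$. (2) The family of all time translates $\{f_\tau\}_{\tau\in\mathbb{R}}$, $f_\tau(t)=f(t+\tau)$, is future asymptotically stable: for every initial data at $t_0$ sufficiently close to $(f(t_0),f'(t_0))$, there is $\tau_0\in\mathbb{R}$ such that the solution $\tilde f$ with that data satisfies $\lim_{t\to\infty}|\tilde f(t)-f_{\tau_0}(t)|=0$.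
   Context: $\mathbb{R}_+=(0,\infty)$. Minkowski space $\mathbb{R}^{1,d+1}$ has coordinates $(t,x)$, $t\in\mathbb{R}$, $x\in\mathbb{R}^{d+1}$. The mean curvature is the trace (not the average) of the second fundamental form with respect to the inward unit normal, so that the unit sphere $\mathbb{S}^d\subset\mathbb{R}^{d+1}$ has mean curvature $d$; by scaling, the positive constant mean curvature is normalised to $d+1$. The equation is autonomous, so time translates of solutions are solutions. *)

theory Defs
  imports "HOL-Analysis.Analysis"
begin

text \<open>Minkowski space of dimension 1 + n is modelled as the product of the time axis with
  Euclidean n-space, carrying the bilinear form of signature (-,+,...,+).\<close>

type_synonym 'n spacetime = "real \<times> (real ^ 'n)"

definition mink :: "'n::finite spacetime \<Rightarrow> 'n spacetime \<Rightarrow> real" where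
  "mink u v = snd u \<bullet> snd v - fst u * fst v"

definition curve_through ::
  "'n::finite spacetime set \<Rightarrow> 'n spacetime \<Rightarrow> 'n spacetime \<Rightarrow> (real \<Rightarrow> 'n spacetime) \<Rightarrow> bool" where
  "curve_through M p v \<gamma> \<longleftrightarrow>
     (\<exists>e>0. \<forall>s. \<bar>s\<bar> < e \<longrightarrow> \<gamma> s \<in> M) \<and> \<gamma> 0 = p \<and> (\<gamma> has_vector_derivative v) (at 0)"

definition tangent_space :: "'n::finite spacetime set \<Rightarrow> 'n spacetime \<Rightarrow> 'n spacetime set" where
  "tangent_space M p = {v. \<exists>\<gamma>. curve_through M p v \<gamma>}"

text \<open>A hypersurface of Minkowski space has Lorentzian induced metric at a point iff its tangent
  space there contains a time-like vector.\<close>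

definition timelike :: "'n::finite spacetime set \<Rightarrow> bool" where
  "timelike M \<longleftrightarrow> (\<forall>p\<in>M. \<exists>v\<in>tangent_space M p. mink v v < 0)"

text \<open>For hypersurfaces that are rotationally symmetric about the time axis, inward means
  pointing towards that axis.\<close>

definition inward_unit_normal ::
  "'n::finite spacetime set \<Rightarrow> ('n spacetime \<Rightarrow> 'n spacetime) \<Rightarrow> bool" where
  "inward_unit_normal M N \<longleftrightarrow>
     (\<forall>p\<in>M. mink (N p) (N p) = 1 \<and> (\<forall>v\<in>tangent_space M p. mink (N p) v = 0)
            \<and> snd (N p) \<bullet> snd p < 0)"

text \<open>The sign is such that the round unit sphere with inward normal has positive definite second
  fundamental form: \<open>h v w = - mink (D\<^sub>v N) w\<close>. Only the values of \<open>h\<close> on tangent vectors matter.\<close>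

definition has_second_fundamental_form ::
  "'n::finite spacetime set \<Rightarrow> ('n spacetime \<Rightarrow> 'n spacetime) \<Rightarrow> 'n spacetime
     \<Rightarrow> ('n spacetime \<Rightarrow> 'n spacetime \<Rightarrow> real) \<Rightarrow> bool" where
  "has_second_fundamental_form M N p h \<longleftrightarrow>
     (\<forall>\<gamma> v. curve_through M p v \<gamma> \<longrightarrow>
        (\<exists>\<nu>. ((\<lambda>s. N (\<gamma> s)) has_vector_derivative \<nu>) (at 0) \<and>
             (\<forall>w\<in>tangent_space M p. h v w = - mink \<nu> w)))"

text \<open>The trace of the second fundamental form with respect to the induced metric is the trace of
  the endomorphism \<open>S\<close> of the tangent space obtained from it by raising an index. Extending \<open>S\<close>
  by zero on the normal line does not change its trace, which can then be computed in the standard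
  basis of the ambient space.\<close>

definition has_mean_curvature ::
  "'n::finite spacetime set \<Rightarrow> ('n spacetime \<Rightarrow> 'n spacetime) \<Rightarrow> 'n spacetime \<Rightarrow> real \<Rightarrow> bool" where
  "has_mean_curvature M N p H \<longleftrightarrow>
     (\<exists>h S. has_second_fundamental_form M N p h \<and> linear S \<and> S (N p) = 0 \<and>
        (\<forall>v\<in>tangent_space M p. S v \<in> tangent_space M p \<and>
           (\<forall>w\<in>tangent_space M p. mink (S v) w = h v w)) \<and>
        H = (\<Sum>b\<in>Basis. S b \<bullet> b))"

definition timelike_cmc_hypersurface :: "real \<Rightarrow> 'n::finite spacetime set \<Rightarrow> bool" where
  "timelike_cmc_hypersurface H M \<longleftrightarrow>
     timelike M \<and> (\<exists>N. inward_unit_normal M N \<and> (\<forall>p\<in>M. has_mean_curvature M N p H))"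

definition spherical_hypersurface :: "(real \<Rightarrow> real) \<Rightarrow> 'n::finite spacetime set" where
  "spherical_hypersurface f = {(t, x). 0 < t \<and> norm x = f t}"

text \<open>Used for open \<open>I\<close> only.\<close>

definition C2_on :: "real set \<Rightarrow> (real \<Rightarrow> real) \<Rightarrow> bool" where
  "C2_on I g \<longleftrightarrow>
     (\<forall>t\<in>I. g differentiable (at t) \<and> deriv g differentiable (at t)) \<and>
     continuous_on I (deriv (deriv g))"

definition cmc_solution_on :: "nat \<Rightarrow> real set \<Rightarrow> (real \<Rightarrow> real) \<Rightarrow> bool" where
  "cmc_solution_on d I g \<longleftrightarrow>
     C2_on I g \<and>
     (\<forall>t\<in>I. g t > 0 \<and> \<bar>deriv g t\<bar> < 1 \<and>
        (1 - (deriv g t)\<^sup>2) * real d + g t * deriv (deriv g) t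
          = (real d + 1) * (1 - (deriv g t)\<^sup>2) powr (3/2) * g t)"

text \<open>Solutions with prescribed data at \<open>t\<^sub>0\<close> that exist for all future times. Being defined slightly
  to the past of \<open>t\<^sub>0\<close> is no restriction (local existence) and avoids one-sided derivatives.\<close>

definition future_solution :: "nat \<Rightarrow> real \<Rightarrow> real \<times> real \<Rightarrow> (real \<Rightarrow> real) \<Rightarrow> bool" where
  "future_solution d t\<^sub>0 p g \<longleftrightarrow>
     (\<exists>s<t\<^sub>0. cmc_solution_on d {s<..} g) \<and> (g t\<^sub>0, deriv g t\<^sub>0) = p"

definition admissible_data :: "(real \<times> real) set" where
  "admissible_data = {0<..} \<times> {-1<..<1}"

definition asymptotic :: "(real \<Rightarrow> real) \<Rightarrow> (real \<Rightarrow> real) \<Rightarrow> bool" where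
  "asymptotic g f \<longleftrightarrow> ((\<lambda>t. \<bar>g t - f t\<bar>) \<longlongrightarrow> 0) at_top"

end

theory Submission
  imports Defs
begin

text \<open>Geometry. At a point \<open>(t, x)\<close> of \<open>\<bar>x\<bar> = f t\<close> put \<open>n = x / f t\<close> and
  \<open>k = 1 / sqrt (1 - f'\<^sup>2)\<close>. The tangent space is the Minkowski complement of the vector
  \<open>(f', n)\<close>, and this vector is space-like exactly when \<open>\<bar>f'\<bar> < 1\<close>; so the inward unit normal is forced to be
  \<open>- k (f', n)\<close>. Differentiating it along curves gives a shape operator with eigenvalue \<open>k / f\<close>
  on the \<open>d\<close> directions tangent to the sphere and \<open>f'' k\<^sup>3\<close> on the time-like direction
  \<open>(1, f' n)\<close>. Setting its trace equal to \<open>d + 1\<close> is the differential equation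
  (\<open>timelike_cmc_spherical_iff\<close>).

  Dynamics. The equation has the first integral \<open>E = f\<^sup>d (k - f)\<close>: along a solution the Lorentz
  factor is \<open>k = G f\<close> with \<open>G r = r + E / r\<^sup>d\<close>, and the momentum \<open>p = k f'\<close> satisfies
  \<open>p' = G' f\<close>. If \<open>f\<close> tends to infinity, then \<open>k\<close> grows like \<open>f\<close>, so \<open>1 - f' = O(1 / f\<^sup>2)\<close> is
  integrable and \<open>f t - t\<close> converges (\<open>unbounded_solution_drift\<close>). Hence any two unbounded
  solutions differ asymptotically by a constant, and a time translation by \<open>\<tau>\<close> changes this
  constant by \<open>\<tau>\<close> (\<open>asymptotic_shift_iff\<close>). That is instability of \<open>f\<close>: the data of \<open>f\<close> at time
  \<open>t\<^sub>0 + \<epsilon>\<close> lie arbitrarily close to those at \<open>t\<^sub>0\<close> and generate a translate of \<open>f\<close>, which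
  stays at distance about \<open>\<epsilon>\<close> from it. It also reduces stability modulo translation to the claim
  that all nearby data generate global solutions tending to infinity.

  For this claim, read \<open>k = G f\<close> as a motion in one dimension that is confined to radii with
  \<open>G \<ge> 1\<close> and can turn only where \<open>G = 1\<close>. Data lead to infinity if either a level below \<open>1\<close> of
  \<open>G\<close> at a smaller radius, with \<open>G' > 0\<close> there, acts as a barrier that reflects the motion
  outwards, or the motion is outwards and \<open>G\<close> is bounded away from \<open>1\<close> ahead of it. Both
  conditions (\<open>escaping\<close>) are stable under perturbation (\<open>eventually_escaping\<close>), and every
  unbounded solution satisfies one of them (\<open>unbounded_solution_escaping\<close>), because
  \<open>G = 1\<close> together with \<open>G' = 0\<close> is an equilibrium, which an unbounded solution cannot meet. In
  both cases the solution is built by solving scalar autonomous equations \<open>x' = \<psi> x\<close>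
  with \<open>\<psi>\<close> between positive constants, that is, by inverting an integral.\<close>

section \<open>The Lorentz factor of a radial motion\<close>

definition lorentz :: "(real \<Rightarrow> real) \<Rightarrow> real \<Rightarrow> real" where
  "lorentz g t = 1 / sqrt (1 - (deriv g t)\<^sup>2)"

lemma
  assumes "\<bar>deriv g t\<bar> < 1"
  shows lorentz_pos: "lorentz g t > 0"
    and lorentz_square: "(lorentz g t)\<^sup>2 * (1 - (deriv g t)\<^sup>2) = 1"
proof -
  have *: "(deriv g t)\<^sup>2 < 1" using assms by (simp add: abs_square_less_1)
  then show "lorentz g t > 0" by (simp add: lorentz_def)
  show "(lorentz g t)\<^sup>2 * (1 - (deriv g t)\<^sup>2) = 1"
    using * by (simp add: lorentz_def power_divide)
qed

lemma has_derivative_lorentz: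
  assumes "\<bar>deriv g t\<bar> < 1" and "deriv g differentiable (at t)"
  shows "(lorentz g has_real_derivative deriv g t * deriv (deriv g) t * lorentz g t ^ 3) (at t)"
proof -
  have *: "(deriv g t)\<^sup>2 < 1" using assms by (simp add: abs_square_less_1)
  have d: "(deriv g has_real_derivative deriv (deriv g) t) (at t)"
    using assms(2) DERIV_deriv_iff_real_differentiable by blast
  have "sqrt (1 - (deriv g t)\<^sup>2) ^ 2 = 1 - (deriv g t)\<^sup>2" using * by simp
  then show ?thesis
    unfolding lorentz_def
    using * by (auto intro!: derivative_eq_intros d simp: field_simps power2_eq_square power3_eq_cube)
qed

text \<open>In this form the left-hand side is the trace of the shape operator. Its difference from
  \<open>d + 1\<close>, multiplied by \<open>g / (lorentz g)\<^sup>3\<close>, is the difference of the two sides of the equation.\<close>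

lemma cmc_equation_iff_lorentz:
  assumes "g t > 0" and "\<bar>deriv g t\<bar> < 1"
  shows "(1 - (deriv g t)\<^sup>2) * real d + g t * deriv (deriv g) t
           = (real d + 1) * (1 - (deriv g t)\<^sup>2) powr (3/2) * g t \<longleftrightarrow>
    real d * lorentz g t / g t + deriv (deriv g) t * lorentz g t ^ 3 = real d + 1"
proof -
  define k where "k = lorentz g t"
  define m where "m = 1 - (deriv g t)\<^sup>2"
  have m: "m > 0" using assms by (simp add: m_def abs_square_less_1)
  have k: "k > 0" "k\<^sup>2 * m = 1" using lorentz_pos lorentz_square assms unfolding k_def m_def by blast+
  have km: "m = 1 / k\<^sup>2" using k by (simp add: field_simps)
  have "m powr (3/2) = (m powr (1/2)) powr 3" by (simp add: powr_powr)
  also have "\<dots> = (m powr (1/2)) ^ 3" using m by (simp add: powr_numeral)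
  also have "m powr (1/2) = 1 / k" using k m unfolding km by (simp add: powr_half_sqrt real_sqrt_divide)
  finally have P: "(1 / k\<^sup>2) powr (3/2) = 1 / k ^ 3" by (simp add: power_divide flip: km)
  let ?q = "deriv (deriv g) t"
  have "m * real d + g t * ?q - (real d + 1) * m powr (3/2) * g t
      = g t / k ^ 3 * (real d * k / g t + ?q * k ^ 3 - (real d + 1))"
    unfolding km P using k(1) assms(1) by (simp add: field_simps power2_eq_square power3_eq_cube)
  moreover have "g t / k ^ 3 \<noteq> 0" using k(1) assms(1) by simp
  ultimately show ?thesis
    unfolding m_def[symmetric] k_def[symmetric] by (metis eq_iff_diff_eq_0 mult_eq_0_iff)
qed

section \<open>Spherically symmetric hypersurfaces\<close>

text \<open>Half the Minkowski gradient of \<open>\<bar>x\<bar>\<^sup>2 - f(t)\<^sup>2\<close> on the hypersurface, divided by \<open>f\<close>; keeping this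
  vector unnormalised describes the tangent space without any assumption on \<open>f'\<close>.\<close>

definition cone_normal :: "(real \<Rightarrow> real) \<Rightarrow> 'n::finite spacetime \<Rightarrow> 'n spacetime" where
  "cone_normal f p = (deriv f (fst p), snd p /\<^sub>R f (fst p))"

definition sph_normal :: "(real \<Rightarrow> real) \<Rightarrow> 'n::finite spacetime \<Rightarrow> 'n spacetime" where
  "sph_normal f p = - lorentz f (fst p) *\<^sub>R cone_normal f p"

lemma mink_simps:
  "mink (u + v) w = mink u w + mink v w" "mink w (u + v) = mink w u + mink w v"
  "mink (u - v) w = mink u w - mink v w" "mink w (u - v) = mink w u - mink w v"
  "mink (c *\<^sub>R u) w = c * mink u w" "mink w (c *\<^sub>R u) = c * mink w u"
  "mink (- u) w = - mink u w" "mink w (- u) = - mink w u"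
  by (simp_all add: mink_def inner_simps algebra_simps)

text \<open>Differentiating \<open>\<bar>x\<bar>\<^sup>2 = f(t)\<^sup>2\<close> along a curve gives one inclusion. For the other, a straight line
  with the given velocity is projected radially onto the hypersurface.\<close>

lemma tangent_space_spherical:
  fixes p :: "'n::finite spacetime"
  assumes p: "p \<in> spherical_hypersurface f" and pos: "\<And>t. t > 0 \<Longrightarrow> f t > 0"
    and diff: "f differentiable (at (fst p))"
  shows "tangent_space (spherical_hypersurface f) p = {v. mink (cone_normal f p) v = 0}"
proof -
  obtain t x where px: "p = (t, x)" by (cases p)
  have t: "t > 0" and nx: "norm x = f t" using p by (auto simp: px spherical_hypersurface_def)
  have ft: "f t > 0" using pos t by blast
  have xx: "x \<bullet> x = f t * f t" using nx by (metis dot_square_norm power2_eq_square)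
  have df: "(f has_real_derivative deriv f t) (at t)"
    using diff DERIV_deriv_iff_real_differentiable by (auto simp: px)
  have char: "mink (cone_normal f p) v = 0 \<longleftrightarrow> x \<bullet> snd v = f t * deriv f t * fst v" for v
    using ft by (auto simp: mink_def cone_normal_def px field_simps)
  have "x \<bullet> snd v = f t * deriv f t * fst v" if c: "curve_through (spherical_hypersurface f) p v \<gamma>" for v \<gamma>
  proof -
    from c obtain e where e: "e > 0" "\<And>s. \<bar>s\<bar> < e \<Longrightarrow> \<gamma> s \<in> spherical_hypersurface f"
      and g0: "\<gamma> 0 = p" and dg: "(\<gamma> has_vector_derivative v) (at 0)"
      unfolding curve_through_def by blast
    have d1: "((\<lambda>s. fst (\<gamma> s)) has_real_derivative fst v) (at 0)"
      using has_derivative_fst[OF dg[unfolded has_vector_derivative_def]]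
      by (simp add: has_field_derivative_def mult_commute_abs)
    have d2: "((\<lambda>s. snd (\<gamma> s)) has_derivative (\<lambda>s. s *\<^sub>R snd v)) (at 0)"
      using has_derivative_snd[OF dg[unfolded has_vector_derivative_def]] by simp
    have a: "((\<lambda>s. snd (\<gamma> s) \<bullet> snd (\<gamma> s)) has_real_derivative 2 * (x \<bullet> snd v)) (at 0)"
      unfolding has_field_derivative_def
      by (rule has_derivative_eq_rhs[OF has_derivative_inner[OF d2 d2]])
         (auto simp: g0 px fun_eq_iff inner_commute)
    have "((\<lambda>s. f (fst (\<gamma> s))) has_real_derivative deriv f t * fst v) (at 0)"
      by (rule DERIV_chain2[OF _ d1]) (simp add: g0 px df)
    then have b: "((\<lambda>s. f (fst (\<gamma> s)) * f (fst (\<gamma> s))) has_real_derivative 2 * (f t * deriv f t * fst v)) (at 0)"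
      by (auto intro!: derivative_eq_intros simp: g0 px)
    have "((\<lambda>s. snd (\<gamma> s) \<bullet> snd (\<gamma> s)) has_real_derivative 2 * (f t * deriv f t * fst v)) (at 0)"
    proof (rule has_field_derivative_transform_within[OF b e(1)])
      fix s :: real assume "dist s 0 < e"
      then have "\<gamma> s \<in> spherical_hypersurface f" using e(2) by simp
      then show "f (fst (\<gamma> s)) * f (fst (\<gamma> s)) = snd (\<gamma> s) \<bullet> snd (\<gamma> s)"
        by (auto simp: spherical_hypersurface_def dot_square_norm power2_eq_square)
    qed simp
    from DERIV_unique[OF a this] show ?thesis by simp
  qed
  moreover have "\<exists>\<gamma>. curve_through (spherical_hypersurface f) p v \<gamma>"
    if v: "x \<bullet> snd v = f t * deriv f t * fst v" for v
  proof -
    obtain a y where vy: "v = (a, y)" by (cases v)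
    define q where "q s = x + s *\<^sub>R y" for s :: real
    define \<gamma> where "\<gamma> s = (t + s * a, (f (t + s * a) / norm (q s)) *\<^sub>R q s)" for s
    have nq: "norm (q 0) = f t" by (simp add: q_def nx)
    have dq: "(q has_derivative (\<lambda>s. s *\<^sub>R y)) (at 0)"
      unfolding q_def by (auto intro!: derivative_eq_intros)
    have "((\<lambda>s. q s \<bullet> q s) has_real_derivative 2 * (x \<bullet> y)) (at 0)"
      unfolding has_field_derivative_def
      by (rule has_derivative_eq_rhs[OF has_derivative_inner[OF dq dq]])
         (auto simp: q_def fun_eq_iff inner_commute)
    then have dn: "((\<lambda>s. norm (q s)) has_real_derivative deriv f t * a) (at 0)"
      unfolding norm_eq_sqrt_inner
      using v ft by (auto intro!: derivative_eq_intros simp: q_def xx vy field_simps)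
    have df2: "((\<lambda>s. f (t + s * a)) has_real_derivative deriv f t * a) (at 0)"
      by (rule DERIV_chain2[where g="\<lambda>s. t + s * a"]) (auto intro!: derivative_eq_intros simp: df)
    have ds: "((\<lambda>s. f (t + s * a) / norm (q s)) has_real_derivative 0) (at 0)"
      by (rule derivative_eq_intros df2 dn refl)+ (use ft in \<open>auto simp: nq\<close>)
    have "((\<lambda>s. (f (t + s * a) / norm (q s)) *\<^sub>R q s) has_derivative (\<lambda>s. s *\<^sub>R y)) (at 0)"
      by (rule has_derivative_eq_rhs[OF has_derivative_scaleR[OF ds[unfolded has_field_derivative_def] dq]])
         (use ft nq in auto)
    moreover have "((\<lambda>s. t + s * a) has_derivative (\<lambda>s. s * a)) (at 0)"
      by (auto intro!: derivative_eq_intros)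
    ultimately have dg: "(\<gamma> has_vector_derivative v) (at 0)"
      unfolding has_vector_derivative_def \<gamma>_def vy
      by (auto intro!: has_derivative_eq_rhs[OF has_derivative_Pair])
    have "((\<lambda>s. t + s * a) \<longlongrightarrow> t + 0 * a) (at 0)" "((\<lambda>s. norm (q s)) \<longlongrightarrow> norm (q 0)) (at 0)"
      unfolding q_def by (intro tendsto_intros)+
    then have "\<forall>\<^sub>F s in at 0. t + s * a > 0" "\<forall>\<^sub>F s in at 0. norm (q s) > 0"
      using order_tendstoD(1)[of _ _ _ 0] t ft nq by force+
    then have "\<forall>\<^sub>F s in at 0. \<gamma> s \<in> spherical_hypersurface f"
      by eventually_elim (use pos in \<open>force simp: \<gamma>_def spherical_hypersurface_def less_imp_le\<close>)
    moreover have g0: "\<gamma> 0 = p" using ft nq by (simp add: \<gamma>_def px q_def)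
    ultimately obtain e where "e > 0" "\<forall>s. s \<noteq> 0 \<and> \<bar>s\<bar> < e \<longrightarrow> \<gamma> s \<in> spherical_hypersurface f"
      unfolding eventually_at by auto
    then have "\<forall>s. \<bar>s\<bar> < e \<longrightarrow> \<gamma> s \<in> spherical_hypersurface f" using g0 p by metis
    then show ?thesis unfolding curve_through_def using \<open>e > 0\<close> g0 dg by blast
  qed
  ultimately show ?thesis unfolding tangent_space_def char by blast
qed

lemma spherical_hypersurface_nonempty_at:
  assumes "t > 0" and "f t > 0"
  shows "\<exists>x :: real ^ 'n::finite. (t, x) \<in> spherical_hypersurface f"
  using assms vector_choose_size[of "f t"]
  by (auto simp: spherical_hypersurface_def less_imp_le)

text \<open>The most time-like tangent direction at a point is that of the moving sphere, \<open>(1, f' n)\<close>, of square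
  \<open>f'\<^sup>2 - 1\<close>; sideways components only add to the square.\<close>

lemma timelike_spherical_iff:
  fixes f :: "real \<Rightarrow> real"
  assumes pos: "\<And>t. t > 0 \<Longrightarrow> f t > 0" and diff: "\<And>t. t > 0 \<Longrightarrow> f differentiable (at t)"
  shows "timelike (spherical_hypersurface f :: 'n::finite spacetime set) \<longleftrightarrow>
    (\<forall>t>0. \<bar>deriv f t\<bar> < 1)"
proof -
  let ?M = "spherical_hypersurface f :: 'n spacetime set"
  have key: "(\<exists>v\<in>tangent_space ?M p. mink v v < 0) \<longleftrightarrow> \<bar>deriv f (fst p)\<bar> < 1" if p: "p \<in> ?M" for p
  proof -
    obtain t x where px: "p = (t, x)" by (cases p)
    have t: "t > 0" and nx: "norm x = f t" using p by (auto simp: px spherical_hypersurface_def)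
    have ft: "f t > 0" using pos t by blast
    define n where "n = x /\<^sub>R f t"
    have nn: "norm n = 1" "n \<bullet> n = 1" using nx ft by (simp_all add: n_def dot_square_norm)
    have T: "v \<in> tangent_space ?M p \<longleftrightarrow> n \<bullet> snd v = deriv f t * fst v" for v
      using tangent_space_spherical[OF p pos] diff[OF t] by (auto simp: px mink_def cone_normal_def n_def)
    show ?thesis
    proof
      assume "\<exists>v\<in>tangent_space ?M p. mink v v < 0"
      then obtain a y where v: "n \<bullet> y = deriv f t * a" "y \<bullet> y < a * a"
        using T by (force simp: mink_def)
      have "\<bar>n \<bullet> y\<bar> \<le> norm y" using Cauchy_Schwarz_ineq2[of n y] nn by simp
      also have "norm y < \<bar>a\<bar>"
        using v(2) by (simp add: norm_eq_sqrt_inner real_less_lsqrt power2_eq_square)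
      finally have "\<bar>deriv f t\<bar> * \<bar>a\<bar> < \<bar>a\<bar>" by (simp add: v abs_mult)
      then have "\<bar>deriv f t\<bar> * \<bar>a\<bar> < 1 * \<bar>a\<bar>" by simp
      then have "\<bar>deriv f t\<bar> < 1" by (rule mult_right_less_imp_less) simp
      then show "\<bar>deriv f (fst p)\<bar> < 1" by (simp add: px)
    next
      assume a: "\<bar>deriv f (fst p)\<bar> < 1"
      have "mink (1, deriv f t *\<^sub>R n) (1, deriv f t *\<^sub>R n) < 0"
        using a nn by (simp add: mink_def px abs_square_less_1 flip: power2_eq_square)
      moreover have "(1, deriv f t *\<^sub>R n) \<in> tangent_space ?M p" using T nn by simp
      ultimately show "\<exists>v\<in>tangent_space ?M p. mink v v < 0" by blast
    qed
  qed
  show ?thesis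
  proof
    assume "timelike ?M"
    then show "\<forall>t>0. \<bar>deriv f t\<bar> < 1"
      using key spherical_hypersurface_nonempty_at[of _ f] pos unfolding timelike_def by (metis fst_conv)
  next
    assume "\<forall>t>0. \<bar>deriv f t\<bar> < 1"
    then show "timelike ?M"
      using key unfolding timelike_def by (auto simp: spherical_hypersurface_def)
  qed
qed

text \<open>Orthogonality to the tangent vectors \<open>(0, y)\<close> with \<open>y\<close> orthogonal to \<open>n\<close> makes the spatial part radial,
  orthogonality to \<open>(1, f' n)\<close> fixes its ratio to the time part, and the norm and the inward
  condition fix the remaining factor.\<close>

lemma inward_unit_normal_spherical_iff:
  fixes f :: "real \<Rightarrow> real" and N :: "'n::finite spacetime \<Rightarrow> 'n spacetime"
  assumes pos: "\<And>t. t > 0 \<Longrightarrow> f t > 0" and diff: "\<And>t. t > 0 \<Longrightarrow> f differentiable (at t)"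
    and slow: "\<And>t. t > 0 \<Longrightarrow> \<bar>deriv f t\<bar> < 1"
  shows "inward_unit_normal (spherical_hypersurface f) N \<longleftrightarrow>
    (\<forall>p\<in>spherical_hypersurface f. N p = sph_normal f p)"
proof -
  have "mink (N p) (N p) = 1 \<and> (\<forall>v\<in>tangent_space (spherical_hypersurface f) p. mink (N p) v = 0)
            \<and> snd (N p) \<bullet> snd p < 0 \<longleftrightarrow> N p = sph_normal f p"
    if p: "p \<in> spherical_hypersurface f" for p
  proof -
    obtain t x where px: "p = (t, x)" by (cases p)
    have t: "t > 0" and nx: "norm x = f t" using p by (auto simp: px spherical_hypersurface_def)
    have ft: "f t > 0" using pos t by blast
    define n where "n = x /\<^sub>R f t"
    have nn: "n \<bullet> n = 1" and xn: "x = f t *\<^sub>R n" using nx ft by (simp_all add: n_def dot_square_norm)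
    let ?f' = "deriv f t" and ?k = "lorentz f t"
    have k: "?k > 0" "?k\<^sup>2 * (1 - ?f'\<^sup>2) = 1" using lorentz_pos lorentz_square slow[OF t] by blast+
    have T: "v \<in> tangent_space (spherical_hypersurface f) p \<longleftrightarrow> n \<bullet> snd v = ?f' * fst v" for v
      using tangent_space_spherical[OF p pos] diff[OF t] by (auto simp: px mink_def cone_normal_def n_def)
    have sn: "sph_normal f p = (- ?k * ?f', (- ?k) *\<^sub>R n)"
      by (simp add: sph_normal_def cone_normal_def px n_def)
    obtain \<alpha> \<beta> where N: "N p = (\<alpha>, \<beta>)" by (cases "N p")
    show ?thesis
    proof
      assume *: "mink (N p) (N p) = 1 \<and> (\<forall>v\<in>tangent_space (spherical_hypersurface f) p. mink (N p) v = 0)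
            \<and> snd (N p) \<bullet> snd p < 0"
      have orth: "mink (N p) v = 0" if "n \<bullet> snd v = ?f' * fst v" for v using * that T by blast
      define c where "c = n \<bullet> \<beta>"
      have "mink (N p) (0, \<beta> - c *\<^sub>R n) = 0" by (rule orth) (simp add: inner_simps nn c_def)
      then have "(\<beta> - c *\<^sub>R n) \<bullet> (\<beta> - c *\<^sub>R n) = 0"
        using nn by (simp add: mink_def N inner_simps inner_commute c_def)
      then have \<beta>: "\<beta> = c *\<^sub>R n" by simp
      have "mink (N p) (1, ?f' *\<^sub>R n) = 0" by (rule orth) (simp add: nn)
      then have \<alpha>: "\<alpha> = c * ?f'" by (simp add: mink_def N \<beta> nn mult.commute)
      have "c\<^sup>2 * (1 - ?f'\<^sup>2) = c * c - (c * ?f') * (c * ?f')"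
        by (simp add: algebra_simps power2_eq_square)
      also have "\<dots> = 1" using conjunct1[OF *] by (simp add: mink_def N \<alpha> \<beta> nn)
      finally have "c\<^sup>2 * (1 - ?f'\<^sup>2) = 1" .
      then have "c\<^sup>2 = ?k\<^sup>2" using k by (metis mult_right_cancel mult_zero_right zero_neq_one)
      moreover have "c < 0" using conjunct2[OF conjunct2[OF *]] ft
        by (simp add: N[unfolded px xn] \<beta> px xn nn mult_less_0_iff)
      ultimately have "c = - ?k" using k(1) by (auto simp: power2_eq_iff)
      then show "N p = sph_normal f p" by (simp add: N \<alpha> \<beta> sn)
    next
      assume "N p = sph_normal f p"
      then have N: "N p = (- ?k * ?f', (- ?k) *\<^sub>R n)" by (simp add: sn)
      show "mink (N p) (N p) = 1 \<and> (\<forall>v\<in>tangent_space (spherical_hypersurface f) p. mink (N p) v = 0)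
            \<and> snd (N p) \<bullet> snd p < 0"
      proof (intro conjI ballI)
        show "mink (N p) (N p) = 1"
          using k by (simp add: N mink_def nn algebra_simps power2_eq_square)
        show "mink (N p) v = 0" if "v \<in> tangent_space (spherical_hypersurface f) p" for v
          using that[unfolded T] by (simp add: N mink_def)
        show "snd (N p) \<bullet> snd p < 0"
          unfolding N using k ft by (simp add: px xn nn)
      qed
    qed
  qed
  then show ?thesis unfolding inward_unit_normal_def by blast
qed

text \<open>The shape operator, extended to the whole of spacetime by sending the normal to zero. The number
  \<open>k\<^sup>2 (a - f' (n \<bullet> y))\<close> is the coefficient of \<open>(1, f' n)\<close> when \<open>(a, y)\<close> is decomposed along
  \<open>(1, f' n)\<close>, the normal and the tangent space of the sphere; so this operator multiplies \<open>(1, f' n)\<close>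
  by \<open>f'' k\<^sup>3\<close> and vectors tangent to the sphere by \<open>k / f\<close>.\<close>

definition sph_shape :: "(real \<Rightarrow> real) \<Rightarrow> 'n::finite spacetime \<Rightarrow> 'n spacetime \<Rightarrow> 'n spacetime" where
  "sph_shape f p v =
     (let t = fst p; n = snd p /\<^sub>R f t; k = lorentz f t;
          c = deriv (deriv f) t * k ^ 5 * (fst v - deriv f t * (n \<bullet> snd v))
      in (c, (k / f t) *\<^sub>R (snd v - (n \<bullet> snd v) *\<^sub>R n) + (c * deriv f t) *\<^sub>R n))"

lemma sph_shape_Pair:
  assumes "n = x /\<^sub>R f t"
  shows "sph_shape f (t, x) v =
     (let c = deriv (deriv f) t * lorentz f t ^ 5 * (fst v - deriv f t * (n \<bullet> snd v))
      in (c, (lorentz f t / f t) *\<^sub>R (snd v - (n \<bullet> snd v) *\<^sub>R n) + (c * deriv f t) *\<^sub>R n))"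
  unfolding sph_shape_def Let_def fst_conv snd_conv assms by (rule refl)

text \<open>Along any curve the normal is \<open>(A, B x)\<close> with coefficients depending on time alone, so it is
  differentiable whenever the curve is, with a derivative that depends only on the velocity.\<close>

lemma sph_normal_derivative_along_curve:
  fixes f :: "real \<Rightarrow> real" and N :: "'n::finite spacetime \<Rightarrow> 'n spacetime"
  assumes pos: "\<And>t. t > 0 \<Longrightarrow> f t > 0" and C2: "C2_on {0<..} f"
    and slow: "\<And>t. t > 0 \<Longrightarrow> \<bar>deriv f t\<bar> < 1"
    and N: "\<And>p. p \<in> spherical_hypersurface f \<Longrightarrow> N p = sph_normal f p"
    and p: "p \<in> spherical_hypersurface f"
    and c: "curve_through (spherical_hypersurface f) p v \<gamma>"
  shows "((\<lambda>s. N (\<gamma> s)) has_vector_derivative - sph_shape f p v) (at 0)"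
proof -
  obtain t x where px: "p = (t, x)" by (cases p)
  obtain a y where vy: "v = (a, y)" by (cases v)
  have t: "t > 0" and nx: "norm x = f t" using p by (auto simp: px spherical_hypersurface_def)
  have ft: "f t > 0" using pos t by blast
  define n where "n = x /\<^sub>R f t"
  have nn: "n \<bullet> n = 1" and xn: "x = f t *\<^sub>R n" using nx ft by (simp_all add: n_def dot_square_norm)
  define f' k f'' where defs: "f' = deriv f t" "k = lorentz f t" "f'' = deriv (deriv f) t"
  have k: "k > 0" "k\<^sup>2 * (1 - f'\<^sup>2) = 1" using lorentz_pos lorentz_square slow[OF t] unfolding defs by blast+
  have diff: "f differentiable (at t)" "deriv f differentiable (at t)" using C2 t by (auto simp: C2_on_def)
  have df: "(f has_real_derivative f') (at t)" "(deriv f has_real_derivative f'') (at t)"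
    using diff DERIV_deriv_iff_real_differentiable by (auto simp: defs)
  have dk: "(lorentz f has_real_derivative f' * f'' * k ^ 3) (at t)"
    using has_derivative_lorentz[OF slow[OF t] diff(2)] by (simp add: defs)
  have "v \<in> tangent_space (spherical_hypersurface f) p" using c by (auto simp: tangent_space_def)
  then have ny: "n \<bullet> y = f' * a"
    using tangent_space_spherical[OF p pos] diff(1)
    by (auto simp: px vy mink_def cone_normal_def n_def defs)
  obtain e where e: "e > 0" "\<And>s. \<bar>s\<bar> < e \<Longrightarrow> \<gamma> s \<in> spherical_hypersurface f"
    and g0: "\<gamma> 0 = p" and dg: "(\<gamma> has_vector_derivative v) (at 0)"
    using c unfolding curve_through_def by blast
  have d1: "((\<lambda>s. fst (\<gamma> s)) has_real_derivative a) (at 0)"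
    using has_derivative_fst[OF dg[unfolded has_vector_derivative_def]]
    by (simp add: has_field_derivative_def mult_commute_abs vy)
  have d2: "((\<lambda>s. snd (\<gamma> s)) has_vector_derivative y) (at 0)"
    using has_derivative_snd[OF dg[unfolded has_vector_derivative_def]]
    by (simp add: vy has_vector_derivative_def)
  \<comment> \<open>The two coefficients of the normal as functions of time.\<close>
  define A where "A = (\<lambda>\<tau>. - (lorentz f \<tau> * deriv f \<tau>))"
  define B where "B = (\<lambda>\<tau>. - (lorentz f \<tau> / f \<tau>))"
  have k2: "k\<^sup>2 * f'\<^sup>2 + 1 = k\<^sup>2" using k(2) by (simp add: algebra_simps)
  have "f' * f'' * k ^ 3 * f' + k * f'' = f'' * k * (k\<^sup>2 * f'\<^sup>2 + 1)"
    by (simp add: power2_eq_square power3_eq_cube algebra_simps)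
  also have "\<dots> = f'' * k ^ 3" unfolding k2 by (simp add: power2_eq_square power3_eq_cube)
  finally have A_eq: "f' * f'' * k ^ 3 * f' + k * f'' = f'' * k ^ 3" .
  have dA: "(A has_real_derivative - (f'' * k ^ 3)) (at t)"
    unfolding A_def
    by (rule derivative_eq_intros dk df refl)+ (use A_eq in \<open>simp add: defs algebra_simps\<close>)
  have dB: "(B has_real_derivative - (f' * f'' * k ^ 3 / f t) + k * f' / (f t)\<^sup>2) (at t)"
    unfolding B_def
    by (rule DERIV_cong[OF DERIV_minus[OF DERIV_divide[OF dk df(1)]]])
      (use ft in \<open>simp_all add: defs field_simps power2_eq_square\<close>)
  have dA': "((\<lambda>s. A (fst (\<gamma> s))) has_real_derivative - (f'' * k ^ 3) * a) (at 0)"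
    by (rule DERIV_chain2[OF _ d1]) (simp add: g0 px dA)
  have dB': "((\<lambda>s. B (fst (\<gamma> s))) has_real_derivative (- (f' * f'' * k ^ 3 / f t) + k * f' / (f t)\<^sup>2) * a) (at 0)"
    by (rule DERIV_chain2[OF _ d1]) (use dB in \<open>simp add: g0 px\<close>)
  have "((\<lambda>s. (A (fst (\<gamma> s)), B (fst (\<gamma> s)) *\<^sub>R snd (\<gamma> s))) has_vector_derivative
      (- (f'' * k ^ 3) * a, B t *\<^sub>R y + ((- (f' * f'' * k ^ 3 / f t) + k * f' / (f t)\<^sup>2) * a) *\<^sub>R x)) (at 0)"
    using has_vector_derivative_Pair[OF dA'[unfolded has_real_derivative_iff_has_vector_derivative]
        has_vector_derivative_scaleR[OF dB' d2]] by (simp add: g0 px)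
  also have "(- (f'' * k ^ 3) * a, B t *\<^sub>R y + ((- (f' * f'' * k ^ 3 / f t) + k * f' / (f t)\<^sup>2) * a) *\<^sub>R x)
      = - sph_shape f p v"
  proof -
    have "k ^ 5 * (a - f' * (n \<bullet> y)) = k ^ 3 * (k\<^sup>2 * (1 - f'\<^sup>2)) * a"
      by (simp add: ny algebra_simps power2_eq_square power3_eq_cube power_numeral_reduce)
    then have c: "f'' * k ^ 5 * (a - f' * (n \<bullet> y)) = f'' * k ^ 3 * a" using k(2) by (simp add: mult.assoc)
    have "sph_shape f p v = (f'' * k ^ 3 * a, (k / f t) *\<^sub>R (y - (f' * a) *\<^sub>R n) + (f'' * k ^ 3 * a * f') *\<^sub>R n)"
      using c by (simp add: sph_shape_Pair[where x=x and f=f and t=t, OF n_def] Let_def px vy defs[symmetric] ny)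
    then show ?thesis
      using ft by (simp add: B_def defs[symmetric] xn algebra_simps power2_eq_square)
  qed
  finally show ?thesis
  proof (rule has_vector_derivative_transform_within[OF _ e(1)])
    fix s :: real assume "dist s 0 < e"
    then have "N (\<gamma> s) = sph_normal f (\<gamma> s)" using e(2) N by simp
    then show "(A (fst (\<gamma> s)), B (fst (\<gamma> s)) *\<^sub>R snd (\<gamma> s)) = N (\<gamma> s)"
      by (simp add: sph_normal_def cone_normal_def A_def B_def divide_inverse)
  qed simp
qed

text \<open>Summing over the standard basis, the time axis contributes \<open>f'' k\<^sup>5\<close> and the space axes the trace of
  \<open>(k / f) (1 - n n\<^sup>T) - f'' k\<^sup>5 f'\<^sup>2 n n\<^sup>T\<close>; the two multiples of \<open>f'' k\<^sup>5\<close> combine by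
  \<open>k\<^sup>2 (1 - f'\<^sup>2) = 1\<close>.\<close>

lemma trace_sph_shape:
  fixes p :: "'n::finite spacetime"
  assumes "snd p \<bullet> snd p = (f (fst p))\<^sup>2" and "f (fst p) > 0" and "\<bar>deriv f (fst p)\<bar> < 1"
  shows "(\<Sum>b\<in>Basis. sph_shape f p b \<bullet> b) =
    (real CARD('n) - 1) * lorentz f (fst p) / f (fst p) + deriv (deriv f) (fst p) * lorentz f (fst p) ^ 3"
proof -
  obtain t x where px: "p = (t, x)" by (cases p)
  define n where "n = x /\<^sub>R f t"
  have nn: "n \<bullet> n = 1" using assms by (simp add: n_def px power2_eq_square field_simps)
  define f' k f'' where defs: "f' = deriv f t" "k = lorentz f t" "f'' = deriv (deriv f) t"
  have k: "k\<^sup>2 * (1 - f'\<^sup>2) = 1" using lorentz_square assms unfolding defs px by auto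
  have sum1: "(\<Sum>b\<in>Basis. (n \<bullet> b) * (n \<bullet> b)) = 1"
    using nn by (simp add: euclidean_inner[of n n])
  have "(\<Sum>b\<in>Basis. sph_shape f p b \<bullet> b) =
    (\<Sum>b\<in>Basis. sph_shape f p (b, 0) \<bullet> (b, 0)) + (\<Sum>b\<in>Basis. sph_shape f p (0, b) \<bullet> (0, b))"
    unfolding Basis_prod_def
    by (subst sum.union_disjoint) (auto simp: sum.reindex inj_on_def)
  also have "(\<Sum>b\<in>Basis. sph_shape f p (b, 0) \<bullet> (b, 0)) = f'' * k ^ 5"
    by (simp add: sph_shape_Pair[where x=x and f=f and t=t, OF n_def] Let_def px defs)
  also have "(\<Sum>b\<in>Basis. sph_shape f p (0, b) \<bullet> (0, b)) =
    (\<Sum>b\<in>(Basis :: (real ^ 'n) set). k / f t - (k / f t + f'' * k ^ 5 * f'\<^sup>2) * ((n \<bullet> b) * (n \<bullet> b)))"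
    by (rule sum.cong)
      (auto simp: sph_shape_Pair[where x=x and f=f and t=t, OF n_def] Let_def px defs[symmetric] inner_simps
        algebra_simps power2_eq_square)
  also have "\<dots> = real CARD('n) * (k / f t) - (k / f t + f'' * k ^ 5 * f'\<^sup>2)"
    by (simp add: sum_subtractf sum1 flip: sum_distrib_left)
  also have "f'' * k ^ 5 + \<dots> = (real CARD('n) - 1) * k / f t + f'' * k ^ 3 * (k\<^sup>2 * (1 - f'\<^sup>2))"
    by (simp add: algebra_simps power2_eq_square power3_eq_cube power_numeral_reduce diff_divide_distrib)
  finally show ?thesis unfolding k by (simp add: px defs)
qed

lemma linear_sph_shape: "linear (sph_shape f p)"
  unfolding sph_shape_def Let_def
  by (rule linearI) (auto simp: inner_simps algebra_simps)

text \<open>The metric is nondegenerate on the tangent space, so the second fundamental form determines the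
  endomorphism on tangent vectors, and its value on the normal is prescribed. Hence it is the shape
  operator, and the mean curvature at a point is unique.\<close>

lemma has_mean_curvature_spherical_iff:
  fixes f :: "real \<Rightarrow> real" and N :: "'n::finite spacetime \<Rightarrow> 'n spacetime"
  assumes pos: "\<And>t. t > 0 \<Longrightarrow> f t > 0" and C2: "C2_on {0<..} f"
    and slow: "\<And>t. t > 0 \<Longrightarrow> \<bar>deriv f t\<bar> < 1"
    and N: "\<And>p. p \<in> spherical_hypersurface f \<Longrightarrow> N p = sph_normal f p"
    and p: "p \<in> spherical_hypersurface f"
  shows "has_mean_curvature (spherical_hypersurface f) N p H \<longleftrightarrow>
    H = (real CARD('n) - 1) * lorentz f (fst p) / f (fst p)
          + deriv (deriv f) (fst p) * lorentz f (fst p) ^ 3"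
proof -
  let ?M = "spherical_hypersurface f :: 'n spacetime set" and ?S = "sph_shape f p"
  let ?T = "tangent_space ?M p"
  obtain t x where px: "p = (t, x)" by (cases p)
  have t: "t > 0" and nx: "norm x = f t" using p by (auto simp: px spherical_hypersurface_def)
  have ft: "f t > 0" using pos t by blast
  define n where "n = x /\<^sub>R f t"
  have nn: "n \<bullet> n = 1" and xn: "x = f t *\<^sub>R n" using nx ft by (simp_all add: n_def dot_square_norm)
  define f' k where defs: "f' = deriv f t" "k = lorentz f t"
  have k: "k > 0" "k\<^sup>2 * (1 - f'\<^sup>2) = 1" using lorentz_pos lorentz_square slow[OF t] unfolding defs by blast+
  have diff: "f differentiable (at (fst p))" using C2 t by (auto simp: C2_on_def px)
  have T: "v \<in> ?T \<longleftrightarrow> mink (cone_normal f p) v = 0" for v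
    using tangent_space_spherical[OF p pos diff] by simp
  have Np: "N p = - k *\<^sub>R cone_normal f p" using N[OF p] by (simp add: sph_normal_def px defs)
  have cn: "cone_normal f p = (f', n)" by (simp add: cone_normal_def px n_def defs)
  have TN: "v \<in> ?T \<longleftrightarrow> mink (N p) v = 0" for v
    unfolding T Np using k(1) by (simp add: mink_simps)
  have NN: "mink (N p) (N p) = 1"
    using k(2) by (simp add: Np mink_simps cn) (simp add: mink_def nn power2_eq_square algebra_simps)
  note S_eq = sph_shape_Pair[where x=x and f=f and t=t, OF n_def, folded px defs]
  have S_N: "?S (N p) = 0"
    unfolding Np cn by (simp add: S_eq Let_def nn zero_prod_def)
  have S_T: "?S v \<in> ?T" for v
    unfolding T cn
    by (simp add: S_eq Let_def nn mink_def inner_simps)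
  have curve: "((\<lambda>s. N (\<gamma> s)) has_vector_derivative - ?S v) (at 0)"
    if "curve_through ?M p v \<gamma>" for v \<gamma>
    using sph_normal_derivative_along_curve[OF pos C2 slow N p that] by blast
  have sff: "has_second_fundamental_form ?M N p h \<longleftrightarrow> (\<forall>v\<in>?T. \<forall>w\<in>?T. h v w = mink (?S v) w)" for h
  proof
    assume h: "has_second_fundamental_form ?M N p h"
    show "\<forall>v\<in>?T. \<forall>w\<in>?T. h v w = mink (?S v) w"
    proof (intro ballI)
      fix v w assume "v \<in> ?T" "w \<in> ?T"
      then obtain \<gamma> \<nu> where "curve_through ?M p v \<gamma>"
        and *: "((\<lambda>s. N (\<gamma> s)) has_vector_derivative \<nu>) (at 0)" "h v w = - mink \<nu> w"
        using h unfolding has_second_fundamental_form_def tangent_space_def by blast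
      then have "\<nu> = - ?S v" using curve vector_derivative_unique_at by blast
      then show "h v w = mink (?S v) w" using * by (simp add: mink_simps)
    qed
  next
    assume h: "\<forall>v\<in>?T. \<forall>w\<in>?T. h v w = mink (?S v) w"
    show "has_second_fundamental_form ?M N p h"
      unfolding has_second_fundamental_form_def
    proof (intro allI impI exI conjI ballI)
      fix \<gamma> v assume c: "curve_through ?M p v \<gamma>"
      show "((\<lambda>s. N (\<gamma> s)) has_vector_derivative - ?S v) (at 0)" by (rule curve[OF c])
      fix w assume "w \<in> ?T"
      moreover have "v \<in> ?T" using c by (auto simp: tangent_space_def)
      ultimately show "h v w = - mink (- ?S v) w" using h by (simp add: mink_simps)
    qed
  qed
  \<comment> \<open>Testing against \<open>(1, f' n)\<close> kills the time component; then \<open>mink u u\<close> is a Euclidean square.\<close>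
  have nondeg: "u = 0" if u: "u \<in> ?T" "\<And>w. w \<in> ?T \<Longrightarrow> mink u w = 0" for u
  proof -
    obtain a y where uay: "u = (a, y)" by (cases u)
    have ny: "n \<bullet> y = f' * a" using u(1) by (simp add: T cn uay mink_def)
    have "(1, f' *\<^sub>R n) \<in> ?T" by (simp add: T cn mink_def nn)
    then have "mink u (1, f' *\<^sub>R n) = 0" by (rule u(2))
    then have "(1 - f'\<^sup>2) * a = 0"
      by (simp add: uay mink_def inner_commute[of y] ny power2_eq_square algebra_simps)
    then have a: "a = 0" using k(2) by (auto simp: mult_eq_0_iff)
    have "mink u u = 0" using u by blast
    then show "u = 0" by (simp add: uay mink_def a zero_prod_def)
  qed
  have uniq: "S = ?S" if S: "linear S" "S (N p) = 0"
    "\<forall>v\<in>?T. S v \<in> ?T \<and> (\<forall>w\<in>?T. mink (S v) w = mink (?S v) w)" for S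
  proof
    fix v
    define u where "u = v - mink (N p) v *\<^sub>R N p"
    have u: "u \<in> ?T" by (simp add: TN u_def mink_simps NN)
    have "S u - ?S u = 0"
      by (rule nondeg) (use S(3) u S_T in \<open>auto simp: TN mink_simps\<close>)
    then have "S u = ?S u" by simp
    moreover have "S u = S v" "?S u = ?S v"
      by (simp_all add: u_def linear_diff[OF S(1)] linear_diff[OF linear_sph_shape]
          linear_scale[OF S(1)] linear_scale[OF linear_sph_shape] S(2) S_N)
    ultimately show "S v = ?S v" by simp
  qed
  have "snd p \<bullet> snd p = (f (fst p))\<^sup>2" using nx by (simp add: px dot_square_norm)
  from trace_sph_shape[of p f, OF this] have tr: "(\<Sum>b\<in>Basis. ?S b \<bullet> b) =
      (real CARD('n) - 1) * lorentz f (fst p) / f (fst p)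
          + deriv (deriv f) (fst p) * lorentz f (fst p) ^ 3" using ft slow[OF t] px by simp
  show ?thesis
    unfolding tr[symmetric]
  proof
    assume "has_mean_curvature ?M N p H"
    then obtain h S where h: "has_second_fundamental_form ?M N p h" and S: "linear S" "S (N p) = 0"
      "\<forall>v\<in>?T. S v \<in> ?T \<and> (\<forall>w\<in>?T. mink (S v) w = h v w)" and H: "H = (\<Sum>b\<in>Basis. S b \<bullet> b)"
      unfolding has_mean_curvature_def by blast
    have "S = ?S" by (rule uniq) (use S h sff in auto)
    then show "H = (\<Sum>b\<in>Basis. ?S b \<bullet> b)" using H by simp
  next
    assume "H = (\<Sum>b\<in>Basis. ?S b \<bullet> b)"
    then show "has_mean_curvature ?M N p H"
      unfolding has_mean_curvature_def
      using sff S_N S_T linear_sph_shape[of f p]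
      by (intro exI[of _ "\<lambda>v w. mink (?S v) w"] exI[of _ ?S]) auto
  qed
qed

lemma timelike_cmc_spherical_iff:
  fixes f :: "real \<Rightarrow> real"
  assumes pos: "\<And>t. t > 0 \<Longrightarrow> f t > 0" and C2: "C2_on {0<..} f" and dim: "CARD('n) = d + 1"
  shows "timelike_cmc_hypersurface (real (d + 1)) (spherical_hypersurface f :: 'n::finite spacetime set)
    \<longleftrightarrow> cmc_solution_on d {0<..} f"
proof -
  let ?M = "spherical_hypersurface f :: 'n spacetime set"
  let ?H = "\<lambda>t. real d * lorentz f t / f t + deriv (deriv f) t * lorentz f t ^ 3"
  have diff: "f differentiable (at t)" if "t > 0" for t using C2 that by (auto simp: C2_on_def)
  have tl: "timelike ?M \<longleftrightarrow> (\<forall>t>0. \<bar>deriv f t\<bar> < 1)"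
    by (rule timelike_spherical_iff) (use pos diff in auto)
  have "(\<exists>N. inward_unit_normal ?M N \<and> (\<forall>p\<in>?M. has_mean_curvature ?M N p (real (d + 1)))) \<longleftrightarrow>
      (\<forall>t>0. ?H t = real d + 1)" if slow: "\<forall>t>0. \<bar>deriv f t\<bar> < 1"
  proof -
    have n: "inward_unit_normal ?M N \<longleftrightarrow> (\<forall>p\<in>?M. N p = sph_normal f p)" for N
      by (rule inward_unit_normal_spherical_iff) (use pos diff slow in auto)
    have h: "has_mean_curvature ?M N p (real (d + 1)) \<longleftrightarrow> ?H (fst p) = real d + 1"
      if "\<forall>p\<in>?M. N p = sph_normal f p" "p \<in> ?M" for N p
      by (subst has_mean_curvature_spherical_iff[OF pos C2]) (use slow that dim in auto)
    have "(\<forall>p\<in>?M. ?H (fst p) = real d + 1) \<longleftrightarrow> (\<forall>t>0. ?H t = real d + 1)"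
    proof
      assume *: "\<forall>p\<in>?M. ?H (fst p) = real d + 1"
      show "\<forall>t>0. ?H t = real d + 1"
      proof (intro allI impI)
        fix t :: real assume t: "t > 0"
        obtain x :: "real ^ 'n" where "(t, x) \<in> ?M"
          using spherical_hypersurface_nonempty_at[of t f] pos t by blast
        with * show "?H t = real d + 1" by fastforce
      qed
    qed (auto simp: spherical_hypersurface_def)
    moreover have "\<forall>p\<in>?M. sph_normal f p = sph_normal f p" by simp
    ultimately show ?thesis using n h by blast
  qed
  moreover have "(1 - (deriv f t)\<^sup>2) * real d + f t * deriv (deriv f) t
           = (real d + 1) * (1 - (deriv f t)\<^sup>2) powr (3/2) * f t \<longleftrightarrow> ?H t = real d + 1"
    if "t > 0" "\<bar>deriv f t\<bar> < 1" for t
    using cmc_equation_iff_lorentz[of f t d] pos that by blast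
  ultimately show ?thesis
    unfolding timelike_cmc_hypersurface_def tl cmc_solution_on_def
    using C2 pos by (cases "\<forall>t>0. \<bar>deriv f t\<bar> < 1") auto
qed

section \<open>Two tools for ordinary differential equations\<close>

text \<open>The function \<open>u t * exp (- K * t)\<close> is nonincreasing.\<close>

lemma gronwall_zero:
  fixes u :: "real \<Rightarrow> real"
  assumes "a \<le> b" and "u a = 0" and "\<And>t. u t \<ge> 0"
    and der: "\<And>t. a \<le> t \<Longrightarrow> t \<le> b \<Longrightarrow> (u has_real_derivative u' t) (at t)"
    and le: "\<And>t. a \<le> t \<Longrightarrow> t \<le> b \<Longrightarrow> u' t \<le> K * u t"
  shows "u b = 0"
proof -
  have "u b * exp (- K * b) \<le> u a * exp (- K * a)"
  proof (rule DERIV_nonpos_imp_nonincreasing[OF assms(1)], intro exI conjI)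
    fix t assume t: "a \<le> t" "t \<le> b"
    show "((\<lambda>t. u t * exp (- K * t)) has_real_derivative (u' t - K * u t) * exp (- K * t)) (at t)"
      by (auto intro!: derivative_eq_intros der t simp: algebra_simps)
    show "(u' t - K * u t) * exp (- K * t) \<le> 0"
      using le[OF t] by (simp add: mult_nonpos_nonneg)
  qed
  then have "u b \<le> 0" using assms(2) by (simp add: mult_le_0_iff)
  with assms(3)[of b] show ?thesis by simp
qed

text \<open>Separation of variables: the solution is the inverse of an antiderivative of \<open>1 / \<psi>\<close>. The bounds on
  \<open>\<psi>\<close> make this antiderivative a bijection of the real line, so the solution exists for all times,
  and force it to grow at least linearly.\<close>

lemma autonomous_ode_between_constants:
  fixes \<psi> :: "real \<Rightarrow> real"
  assumes cont: "continuous_on UNIV \<psi>" and "c > 0"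
    and lower: "\<And>x. c \<le> \<psi> x" and upper: "\<And>x. \<psi> x \<le> C"
  obtains x where "x t\<^sub>0 = x\<^sub>0" and "\<And>t. (x has_real_derivative \<psi> (x t)) (at t)"
    and "strict_mono x" and "filterlim x at_top at_top"
proof -
  have pos: "\<psi> y > 0" for y using lower[of y] \<open>c > 0\<close> by linarith
  have C: "C > 0" using pos[of 0] upper[of 0] by linarith
  have "isCont (\<lambda>y. 1 / \<psi> y) y" for y
    using cont pos[of y] by (intro continuous_intros) (auto simp: continuous_on_eq_continuous_at)
  then obtain T\<^sub>0 where T\<^sub>0: "(T\<^sub>0 has_real_derivative 1 / \<psi> y) (at y)" for y
    using einterval_antiderivative[of "-\<infinity>" "\<infinity>" "\<lambda>y. 1 / \<psi> y"]
    by (auto simp: has_real_derivative_iff_has_vector_derivative)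
  define T where "T y = T\<^sub>0 y - T\<^sub>0 x\<^sub>0 + t\<^sub>0" for y
  have dT: "(T has_real_derivative 1 / \<psi> y) (at y)" for y
    unfolding T_def by (auto intro!: derivative_eq_intros T\<^sub>0)
  have Tx0: "T x\<^sub>0 = t\<^sub>0" by (simp add: T_def)
  have grow: "(z - y) / C \<le> T z - T y" if "y \<le> z" for y z
  proof -
    have "T y - y / C \<le> T z - z / C"
    proof (rule DERIV_nonneg_imp_nondecreasing[OF that], intro exI conjI)
      fix w
      show "((\<lambda>w. T w - w / C) has_real_derivative 1 / \<psi> w - 1 / C) (at w)"
        by (rule DERIV_diff[OF dT DERIV_cdivide[OF DERIV_ident]])
      show "0 \<le> 1 / \<psi> w - 1 / C" using upper[of w] pos[of w] by (simp add: frac_le)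
    qed
    then show ?thesis by (simp add: diff_divide_distrib)
  qed
  have "\<exists>y. T y = t" for t
  proof -
    define r where "r = C * \<bar>t - t\<^sub>0\<bar>"
    have r: "r \<ge> 0" using C by (simp add: r_def)
    have "T (x\<^sub>0 - r) \<le> t" "t \<le> T (x\<^sub>0 + r)"
      using grow[of "x\<^sub>0 - r" x\<^sub>0] grow[of x\<^sub>0 "x\<^sub>0 + r"] r C by (auto simp: Tx0 r_def)
    moreover have "\<forall>w. isCont T w" using dT DERIV_isCont by blast
    ultimately show ?thesis using IVT[of T "x\<^sub>0 - r" t "x\<^sub>0 + r"] r by auto
  qed
  then obtain x where x: "T (x t) = t" for t by metis
  have inj: "y = z" if "T y = T z" for y z
    
  proof (rule ccontr)
    assume "y \<noteq> z"
    then consider "y < z" | "z < y" by linarith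
    then show False
      using DERIV_pos_imp_increasing[of _ _ T] dT pos that
      by cases (metis divide_pos_pos less_irrefl zero_less_one)+
  qed
  have lip: "\<bar>x s - x t\<bar> \<le> C * \<bar>s - t\<bar>" for s t
  proof -
    have "\<bar>x s - x t\<bar> / C \<le> \<bar>s - t\<bar>"
      using grow[of "x s" "x t"] grow[of "x t" "x s"] by (cases "x s \<le> x t") (simp_all add: x)
    then show ?thesis using C by (simp add: pos_divide_le_eq mult.commute)
  qed
  have "isCont x t" for t
  proof -
    have "((\<lambda>s. C * \<bar>s - t\<bar>) \<longlongrightarrow> C * \<bar>t - t\<bar>) (at t)" by (intro tendsto_intros)
    then have "((\<lambda>s. C * \<bar>s - t\<bar>) \<longlongrightarrow> 0) (at t)" by simp
    then have "((\<lambda>s. x s - x t) \<longlongrightarrow> 0) (at t)"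
      by (rule Lim_null_comparison[rotated])
        (simp only: real_norm_def, intro always_eventually allI lip)
    then show "isCont x t" unfolding isCont_def by (rule LIM_zero_cancel)
  qed
  then have dx: "(x has_real_derivative \<psi> (x t)) (at t)" for t
    using DERIV_inverse_function[of T "1 / \<psi> (x t)" x t "t - 1" "t + 1"] dT pos[of "x t"] x by simp
  have mono: "strict_mono x"
    by (rule strict_monoI, rule DERIV_pos_imp_increasing) (use dx pos in blast)+
  have lb: "x t\<^sub>0 + c * (t - t\<^sub>0) \<le> x t" if "t\<^sub>0 \<le> t" for t
  proof -
    have "x t\<^sub>0 - c * t\<^sub>0 \<le> x t - c * t"
    proof (rule DERIV_nonneg_imp_nondecreasing[OF that], intro exI conjI)
      fix w
      show "((\<lambda>w. x w - c * w) has_real_derivative \<psi> (x w) - c) (at w)"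
        by (auto intro!: derivative_eq_intros dx)
      show "0 \<le> \<psi> (x w) - c" using lower by simp
    qed
    then show ?thesis by (simp add: algebra_simps)
  qed
  have "filterlim (\<lambda>t. (x t\<^sub>0 - c * t\<^sub>0) + c * t) at_top at_top"
    by (intro filterlim_tendsto_add_at_top[OF tendsto_const] filterlim_tendsto_pos_mult_at_top[OF tendsto_const]
        \<open>c > 0\<close> filterlim_ident)
  then have "filterlim x at_top at_top"
    by (rule filterlim_at_top_mono)
      (use lb in \<open>auto intro!: eventually_mono[OF eventually_ge_at_top[of t\<^sub>0]] simp: algebra_simps\<close>)
  moreover have "x t\<^sub>0 = x\<^sub>0" by (rule inj) (simp add: x Tx0)
  ultimately show ?thesis using that dx mono by blast
qed

section \<open>The first integral\<close>

text \<open>The Lorentz factor that a solution of energy \<open>E\<close> has at radius \<open>r\<close>.\<close>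

definition level :: "nat \<Rightarrow> real \<Rightarrow> real \<Rightarrow> real" where
  "level d E r = r + E / r ^ d"

text \<open>The derivative of \<open>level d E\<close>, which drives the momentum.\<close>

definition force :: "nat \<Rightarrow> real \<Rightarrow> real \<Rightarrow> real" where
  "force d E r = 1 - real d * E / r ^ Suc d"

text \<open>The energy of the solution with radius \<open>a\<close> and velocity \<open>v\<close>, chosen so that \<open>level d E a\<close> is the
  Lorentz factor belonging to \<open>v\<close>.\<close>

definition energy :: "nat \<Rightarrow> real \<Rightarrow> real \<Rightarrow> real" where
  "energy d a v = a ^ d * (1 / sqrt (1 - v\<^sup>2) - a)"

text \<open>The equation as a Hamiltonian system on the energy surface, with momentum \<open>p\<close> equal to Lorentz factor
  times velocity, so that \<open>sqrt (1 + p\<^sup>2)\<close> is the Lorentz factor. In these variables the velocity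
  is globally Lipschitz in \<open>p\<close> and the force depends on the radius alone.\<close>

definition cmc_flow :: "nat \<Rightarrow> real \<Rightarrow> real set \<Rightarrow> (real \<Rightarrow> real) \<Rightarrow> (real \<Rightarrow> real) \<Rightarrow> bool" where
  "cmc_flow d E I g p \<longleftrightarrow>
     (\<forall>t\<in>I. g t > 0 \<and> (g has_real_derivative p t / sqrt (1 + (p t)\<^sup>2)) (at t) \<and>
        (p has_real_derivative force d E (g t)) (at t) \<and> sqrt (1 + (p t)\<^sup>2) = level d E (g t))"

lemma DERIV_level:
  assumes "r > 0"
  shows "(level d E has_real_derivative force d E r) (at r)"
proof (cases d)
  case (Suc n)
  have "((\<lambda>r. r + E / r ^ d) has_real_derivative
      1 + (0 * r ^ d - E * (real d * r ^ (d - 1))) / (r ^ d * r ^ d)) (at r)"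
    by (intro DERIV_add DERIV_divide DERIV_ident DERIV_const)
      (use assms DERIV_pow[of d r] in auto)
  moreover have "1 + (0 * r ^ d - E * (real d * r ^ (d - 1))) / (r ^ d * r ^ d) = force d E r"
    using assms by (simp add: Suc force_def field_simps)
  ultimately show ?thesis unfolding level_def by simp
next
  case 0
  have "((\<lambda>r. r + E) has_real_derivative 1 + 0) (at r)"
    by (intro DERIV_add DERIV_ident DERIV_const)
  moreover have "level d E = (\<lambda>r. r + E)" by (simp add: 0 level_def fun_eq_iff)
  ultimately show ?thesis by (simp add: 0 force_def)
qed

lemma continuous_on_force: "continuous_on {0<..} (force d E)"
  unfolding force_def by (intro continuous_intros) auto

lemma continuous_on_level: "continuous_on {0<..} (level d E)"
  unfolding level_def by (intro continuous_intros) auto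

text \<open>With \<open>w = sqrt (1 + p\<^sup>2)\<close> the system gives \<open>g'' = force / w\<^sup>3\<close>, and the energy identity
  \<open>w = level\<close> turns \<open>d w / g + g'' w\<^sup>3\<close> into the constant \<open>d + 1\<close>.\<close>

lemma cmc_flow_imp_solution:
  assumes I: "open I" and flow: "cmc_flow d E I g p"
  shows "cmc_solution_on d I g" and "\<And>t. t \<in> I \<Longrightarrow> deriv g t = p t / sqrt (1 + (p t)\<^sup>2)"
proof -
  define w where "w t = sqrt (1 + (p t)\<^sup>2)" for t
  have w: "w t > 0" "(w t)\<^sup>2 = 1 + (p t)\<^sup>2" for t
    by (auto simp: w_def add_pos_nonneg)
  have g: "g t > 0" "(g has_real_derivative p t / w t) (at t)"
    "(p has_real_derivative force d E (g t)) (at t)" "w t = level d E (g t)" if "t \<in> I" for t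
    using flow that unfolding cmc_flow_def w_def by auto
  have dg: "deriv g t = p t / w t" if "t \<in> I" for t
    using g(2)[OF that] DERIV_imp_deriv by blast
  then show "\<And>t. t \<in> I \<Longrightarrow> deriv g t = p t / sqrt (1 + (p t)\<^sup>2)" by (simp add: w_def)
  have ddg: "(deriv g has_real_derivative force d E (g t) / w t ^ 3) (at t)" if t: "t \<in> I" for t
  proof -
    have "1 + (p t)\<^sup>2 > 0" by (simp add: add_pos_nonneg)
    then have dw: "(w has_real_derivative p t * force d E (g t) / w t) (at t)"
      unfolding w_def
      by (auto intro!: derivative_eq_intros g(3) t simp: field_simps)
    have "((\<lambda>t. p t / w t) has_real_derivative
        (force d E (g t) * w t - p t * (p t * force d E (g t) / w t)) / (w t * w t)) (at t)"
      by (rule DERIV_divide[OF g(3)[OF t] dw]) (use w(1)[of t] in simp)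
    also have "(force d E (g t) * w t - p t * (p t * force d E (g t) / w t)) / (w t * w t)
        = force d E (g t) * ((w t)\<^sup>2 - (p t)\<^sup>2) / w t ^ 3"
      using w(1)[of t] by (simp add: field_simps power2_eq_square power3_eq_cube)
    finally have "((\<lambda>t. p t / w t) has_real_derivative force d E (g t) / w t ^ 3) (at t)"
      by (simp add: w(2))
    then show ?thesis
      by (rule has_field_derivative_transform_within_open[OF _ I t]) (simp add: dg)
  qed
  have d2: "deriv (deriv g) t = force d E (g t) / w t ^ 3" if "t \<in> I" for t
    using ddg[OF that] DERIV_imp_deriv by blast
  have cont: "continuous_on I g" "continuous_on I p"
    using g(2,3) DERIV_isCont by (blast intro: continuous_at_imp_continuous_on)+
  have "continuous_on I (\<lambda>t. force d E (g t) / w t ^ 3)"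
  proof (intro continuous_on_divide)
    show "continuous_on I (\<lambda>t. force d E (g t))"
      by (rule continuous_on_compose2[OF continuous_on_force cont(1)]) (use g(1) in auto)
    show "continuous_on I (\<lambda>t. w t ^ 3)" unfolding w_def by (intro continuous_intros cont)
    show "\<forall>t\<in>I. w t ^ 3 \<noteq> 0" using w(1) by (metis less_irrefl power_not_zero)
  qed
  then have "continuous_on I (deriv (deriv g))"
    by (rule continuous_on_eq) (simp add: d2)
  then have C2: "C2_on I g"
    using g(2) ddg unfolding C2_on_def real_differentiable_def by blast
  show "cmc_solution_on d I g"
    unfolding cmc_solution_on_def
  proof (intro conjI ballI C2)
    fix t assume t: "t \<in> I"
    show "g t > 0" by (rule g(1)[OF t])
    have "\<bar>p t\<bar> < w t" unfolding w_def by (rule real_less_rsqrt) simp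
    then show slow: "\<bar>deriv g t\<bar> < 1" using w(1)[of t] by (simp add: dg[OF t])
    have "1 - (deriv g t)\<^sup>2 = ((w t)\<^sup>2 - (p t)\<^sup>2) / (w t)\<^sup>2"
      using w(1)[of t] by (simp add: dg[OF t] power_divide diff_divide_distrib)
    also have "\<dots> = 1 / (w t)\<^sup>2" by (simp add: w(2))
    finally have "1 - (deriv g t)\<^sup>2 = 1 / (w t)\<^sup>2" .
    then have k: "lorentz g t = w t"
      using w(1)[of t] by (simp add: lorentz_def real_sqrt_divide)
    have "real d * w t / g t + force d E (g t) / w t ^ 3 * w t ^ 3 = real d + 1"
      using w(1)[of t] g(1)[OF t] by (simp add: g(4)[OF t]) (simp add: level_def force_def field_simps)
    then show "(1 - (deriv g t)\<^sup>2) * real d + g t * deriv (deriv g) t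
          = (real d + 1) * (1 - (deriv g t)\<^sup>2) powr (3/2) * g t"
      using cmc_equation_iff_lorentz[of g t d, OF g(1)[OF t] slow] by (simp only: k d2[OF t])
  qed
qed

text \<open>The equation makes \<open>g\<^sup>d (k - g)\<close> constant, where \<open>k\<close> is the Lorentz factor: its derivative is
  \<open>g' g\<^sup>d\<close> times the defect \<open>d k / g + g'' k\<^sup>3 - (d + 1)\<close>. The same identity evaluates
  the derivative of the momentum, which is \<open>g'' k\<^sup>3\<close>.\<close>

lemma cmc_solution_imp_flow:
  assumes d: "d \<ge> 1" and sol: "cmc_solution_on d {s<..} g" and t\<^sub>0: "t\<^sub>0 > s"
  shows "cmc_flow d (energy d (g t\<^sub>0) (deriv g t\<^sub>0)) {s<..} g (\<lambda>t. lorentz g t * deriv g t)"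
proof -
  let ?k = "lorentz g" and ?q = "deriv (deriv g)"
  define E where "E = energy d (g t\<^sub>0) (deriv g t\<^sub>0)"
  define H where "H t = g t ^ d * (?k t - g t)" for t
  have pos: "g t > 0" and slow: "\<bar>deriv g t\<bar> < 1" and diff: "g differentiable (at t)" "deriv g differentiable (at t)"
    if "t > s" for t
    using sol that unfolding cmc_solution_on_def C2_on_def by auto
  have eq: "real d * ?k t / g t + ?q t * ?k t ^ 3 = real d + 1" if "t > s" for t
    using cmc_equation_iff_lorentz[of g t d] sol that unfolding cmc_solution_on_def by auto
  have k: "?k t > 0" "(?k t)\<^sup>2 * (1 - (deriv g t)\<^sup>2) = 1" if "t > s" for t
    using lorentz_pos lorentz_square slow[OF that] by blast+
  have dg: "(g has_real_derivative deriv g t) (at t)" "(deriv g has_real_derivative ?q t) (at t)" if "t > s" for t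
    using diff[OF that] DERIV_deriv_iff_real_differentiable by auto
  have dk: "(?k has_real_derivative deriv g t * ?q t * ?k t ^ 3) (at t)" if "t > s" for t
    using has_derivative_lorentz[OF slow[OF that] diff(2)[OF that]] .
  have "(H has_real_derivative 0) (at t)" if t: "t > s" for t
  proof -
    have "(H has_real_derivative
        (real d * (deriv g t * g t ^ (d - 1))) * (?k t - g t) + (deriv g t * ?q t * ?k t ^ 3 - deriv g t) * g t ^ d) (at t)"
      unfolding H_def
      by (auto intro!: derivative_eq_intros dg dk t)
    also have "g t ^ d = g t * g t ^ (d - 1)" using d by (metis One_nat_def Suc_pred less_eq_Suc_le power_Suc)
    also have "(real d * (deriv g t * g t ^ (d - 1))) * (?k t - g t) + (deriv g t * ?q t * ?k t ^ 3 - deriv g t) * (g t * g t ^ (d - 1))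
      = deriv g t * g t ^ (d - 1) * (g t * (real d * ?k t / g t + ?q t * ?k t ^ 3 - (real d + 1)))"
      using pos[OF t] by (simp add: field_simps)
    finally show ?thesis using eq[OF t] by simp
  qed
  then have "H t = H t\<^sub>0" if "t > s" for t
    using DERIV_isconst3[of s "max t t\<^sub>0 + 1" t t\<^sub>0 H] that t\<^sub>0 by auto
  then have HE: "H t = E" if "t > s" for t
    using that by (simp add: E_def energy_def H_def lorentz_def)
  have kG: "?k t = level d E (g t)" if t: "t > s" for t
    using HE[OF t] pos[OF t] by (simp add: H_def level_def field_simps)
  have p1: "1 + (?k t * deriv g t)\<^sup>2 = (?k t)\<^sup>2" if "t > s" for t
    using k(2)[OF that] by (simp add: power_mult_distrib algebra_simps)
  show ?thesis
    unfolding cmc_flow_def E_def[symmetric]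
  proof (intro ballI)
    fix t assume "t \<in> {s<..}"
    then have t: "t > s" by simp
    have w: "sqrt (1 + (?k t * deriv g t)\<^sup>2) = ?k t" using p1[OF t] k(1)[OF t] by simp
    have "((\<lambda>t. ?k t * deriv g t) has_real_derivative deriv g t * ?q t * ?k t ^ 3 * deriv g t + ?q t * ?k t) (at t)"
      by (rule DERIV_mult[OF dk[OF t] dg(2)[OF t]])
    also have "deriv g t * ?q t * ?k t ^ 3 * deriv g t + ?q t * ?k t = ?q t * ?k t * (1 + (?k t * deriv g t)\<^sup>2)"
      by (simp add: algebra_simps power2_eq_square power3_eq_cube)
    also have "\<dots> = real d + 1 - real d * ?k t / g t"
      using eq[OF t] p1[OF t] by (simp add: power2_eq_square power3_eq_cube algebra_simps)
    also have "\<dots> = force d E (g t)"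
      using pos[OF t] by (simp add: kG[OF t] force_def level_def field_simps)
    finally show "g t > 0 \<and> (g has_real_derivative ?k t * deriv g t / sqrt (1 + (?k t * deriv g t)\<^sup>2)) (at t) \<and>
        ((\<lambda>t. ?k t * deriv g t) has_real_derivative force d E (g t)) (at t) \<and>
        sqrt (1 + (?k t * deriv g t)\<^sup>2) = level d E (g t)"
      unfolding w using pos[OF t] kG[OF t] dg(1)[OF t] k(1)[OF t] by simp
  qed
qed

section \<open>Forward uniqueness\<close>

lemma cmc_flowD:
  assumes "cmc_flow d E I g p" and "t \<in> I"
  shows "g t > 0" and "(g has_real_derivative p t / sqrt (1 + (p t)\<^sup>2)) (at t)"
    and "(p has_real_derivative force d E (g t)) (at t)" and "sqrt (1 + (p t)\<^sup>2) = level d E (g t)"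
  using assms unfolding cmc_flow_def by blast+

lemma cmc_flow_subset: "cmc_flow d E I g p \<Longrightarrow> J \<subseteq> I \<Longrightarrow> cmc_flow d E J g p"
  unfolding cmc_flow_def by blast

text \<open>The derivative of \<open>p / sqrt (1 + p\<^sup>2)\<close> is \<open>1 / sqrt (1 + p\<^sup>2) ^ 3\<close>.\<close>

lemma lipschitz_velocity:
  fixes p q :: real
  shows "\<bar>p / sqrt (1 + p\<^sup>2) - q / sqrt (1 + q\<^sup>2)\<bar> \<le> \<bar>p - q\<bar>"
proof -
  have w: "1 + x\<^sup>2 > 0" for x :: real by (simp add: add_pos_nonneg)
  have "norm (p / sqrt (1 + p\<^sup>2) - q / sqrt (1 + q\<^sup>2)) \<le> 1 * norm (p - q)"
  proof (rule field_differentiable_bound[of UNIV])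
    fix x :: real
    let ?w = "sqrt (1 + x\<^sup>2)"
    have s: "?w * ?w = 1 + x\<^sup>2" "?w > 0" "?w \<ge> 1" using w[of x] by auto
    have "((\<lambda>x. x / sqrt (1 + x\<^sup>2)) has_real_derivative (1 * ?w - x * (x / ?w)) / (?w * ?w)) (at x)"
      by (rule DERIV_divide) (use w[of x] in \<open>auto intro!: derivative_eq_intros simp: field_simps\<close>)
    moreover have "(1 * ?w - x * (x / ?w)) / (?w * ?w) = 1 / ?w ^ 3"
    proof -
      have "1 * ?w - x * (x / ?w) = (?w * ?w - x\<^sup>2) / ?w" using s(2) by (simp add: field_simps power2_eq_square)
      also have "?w * ?w - x\<^sup>2 = 1" using s(1) by simp
      finally show ?thesis by (simp add: power3_eq_cube)
    qed
    ultimately show "((\<lambda>x. x / sqrt (1 + x\<^sup>2)) has_real_derivative 1 / ?w ^ 3) (at x within UNIV)" by simp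
    have "1 \<le> ?w ^ 3" by (rule one_le_power[OF s(3)])
    then show "norm (1 / ?w ^ 3) \<le> 1" using s(2) by simp
  qed auto
  then show ?thesis by simp
qed

lemma lipschitz_force:
  assumes "m > 0"
  obtains L where "L \<ge> 0" and "\<And>r q. r \<ge> m \<Longrightarrow> q \<ge> m \<Longrightarrow> \<bar>force d E r - force d E q\<bar> \<le> L * \<bar>r - q\<bar>"
proof
  let ?L = "real d * \<bar>E\<bar> * (real (Suc d) / m ^ Suc (Suc d))"
  show "?L \<ge> 0" using assms by simp
  fix r q assume rq: "r \<ge> m" "q \<ge> m"
  have "norm (force d E r - force d E q) \<le> ?L * norm (r - q)"
  proof (rule field_differentiable_bound[of "{m..}"])
    fix x assume "x \<in> {m..}"
    then have x: "x \<ge> m" "x > 0" using assms by auto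
    have "((\<lambda>r. 1 - real d * E / r ^ Suc d) has_real_derivative
        0 - (0 * x ^ Suc d - real d * E * (real (Suc d) * x ^ (Suc d - 1))) / (x ^ Suc d * x ^ Suc d)) (at x)"
      by (intro DERIV_diff DERIV_divide DERIV_const)
        (use x DERIV_pow[of "Suc d" x] in \<open>simp_all del: power_Suc\<close>)
    moreover have "0 - (0 * x ^ Suc d - real d * E * (real (Suc d) * x ^ (Suc d - 1))) / (x ^ Suc d * x ^ Suc d)
        = real d * E * (real (Suc d) / x ^ Suc (Suc d))"
      using x by (simp add: field_simps)
    ultimately show "(force d E has_real_derivative real d * E * (real (Suc d) / x ^ Suc (Suc d))) (at x within {m..})"
      unfolding force_def[abs_def] by (metis has_field_derivative_at_within)
    have "real (Suc d) / x ^ Suc (Suc d) \<le> real (Suc d) / m ^ Suc (Suc d)"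
      using x assms by (intro divide_left_mono power_mono mult_pos_pos zero_less_power) auto
    then have "real d * \<bar>E\<bar> * (real (Suc d) / x ^ Suc (Suc d)) \<le> ?L"
      by (rule mult_left_mono) simp
    moreover have "norm (real d * E * (real (Suc d) / x ^ Suc (Suc d)))
        = real d * \<bar>E\<bar> * (real (Suc d) / x ^ Suc (Suc d))"
      using x by (simp add: abs_mult)
    ultimately show "norm (real d * E * (real (Suc d) / x ^ Suc (Suc d))) \<le> ?L" by simp
  qed (use rq in auto)
  then show "\<bar>force d E r - force d E q\<bar> \<le> ?L * \<bar>r - q\<bar>" by simp
qed

text \<open>On a compact time interval both radii stay above a positive constant, where the force is Lipschitz;
  then the squared distance of the two phase-space curves satisfies a linear differential
  inequality.\<close>

lemma cmc_flow_unique_forward: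
  assumes f1: "cmc_flow d E {s<..} g\<^sub>1 p\<^sub>1" and f2: "cmc_flow d E {s<..} g\<^sub>2 p\<^sub>2"
    and a: "s < a" and eq: "g\<^sub>1 a = g\<^sub>2 a" "p\<^sub>1 a = p\<^sub>2 a" and b: "a \<le> b"
  shows "g\<^sub>1 b = g\<^sub>2 b"
proof -
  have D1: "g\<^sub>1 t > 0" "(g\<^sub>1 has_real_derivative p\<^sub>1 t / sqrt (1 + (p\<^sub>1 t)\<^sup>2)) (at t)"
    "(p\<^sub>1 has_real_derivative force d E (g\<^sub>1 t)) (at t)" if "t \<ge> a" for t
    using cmc_flowD[OF f1, of t] a that by auto
  have D2: "g\<^sub>2 t > 0" "(g\<^sub>2 has_real_derivative p\<^sub>2 t / sqrt (1 + (p\<^sub>2 t)\<^sup>2)) (at t)"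
    "(p\<^sub>2 has_real_derivative force d E (g\<^sub>2 t)) (at t)" if "t \<ge> a" for t
    using cmc_flowD[OF f2, of t] a that by auto
  have c: "continuous_on {a..b} (\<lambda>t. min (g\<^sub>1 t) (g\<^sub>2 t))"
    using D1(2) D2(2) DERIV_isCont
    by (intro continuous_on_min continuous_at_imp_continuous_on ballI) fastforce+
  obtain c where c: "c \<in> {a..b}" "\<And>t. t \<in> {a..b} \<Longrightarrow> min (g\<^sub>1 c) (g\<^sub>2 c) \<le> min (g\<^sub>1 t) (g\<^sub>2 t)"
    using continuous_attains_inf[OF compact_Icc _ c] b by fastforce
  define m where "m = min (g\<^sub>1 c) (g\<^sub>2 c)"
  have m: "m > 0" "\<And>t. a \<le> t \<Longrightarrow> t \<le> b \<Longrightarrow> g\<^sub>1 t \<ge> m \<and> g\<^sub>2 t \<ge> m"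
    using c D1(1) D2(1) by (auto simp: m_def)
  obtain L where L: "L \<ge> 0" "\<And>r q. r \<ge> m \<Longrightarrow> q \<ge> m \<Longrightarrow> \<bar>force d E r - force d E q\<bar> \<le> L * \<bar>r - q\<bar>"
    using lipschitz_force[OF m(1)] by blast
  define x where "x t = g\<^sub>1 t - g\<^sub>2 t" for t
  define y where "y t = p\<^sub>1 t - p\<^sub>2 t" for t
  define u where "u t = (x t)\<^sup>2 + (y t)\<^sup>2" for t
  define V where "V t = p\<^sub>1 t / sqrt (1 + (p\<^sub>1 t)\<^sup>2) - p\<^sub>2 t / sqrt (1 + (p\<^sub>2 t)\<^sup>2)" for t
  define F where "F t = force d E (g\<^sub>1 t) - force d E (g\<^sub>2 t)" for t
  have "u b = 0"
  proof (rule gronwall_zero[OF b, where K="1 + L"])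
    show "u a = 0" by (simp add: u_def x_def y_def eq)
    show "u t \<ge> 0" for t by (simp add: u_def)
    fix t assume t: "a \<le> t" "t \<le> b"
    have "(x has_real_derivative V t) (at t)" "(y has_real_derivative F t) (at t)"
      unfolding x_def V_def y_def F_def by (intro DERIV_diff D1 D2 t)+
    then show "(u has_real_derivative 2 * x t * V t + 2 * y t * F t) (at t)"
      unfolding u_def by (auto intro!: derivative_eq_intros)
    have "\<bar>V t\<bar> \<le> \<bar>y t\<bar>" unfolding V_def y_def by (rule lipschitz_velocity)
    then have "\<bar>x t\<bar> * \<bar>V t\<bar> \<le> \<bar>x t\<bar> * \<bar>y t\<bar>" by (rule mult_left_mono) simp
    then have "x t * V t \<le> \<bar>x t\<bar> * \<bar>y t\<bar>" using abs_ge_self[of "x t * V t"] unfolding abs_mult by linarith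
    moreover have "\<bar>F t\<bar> \<le> L * \<bar>x t\<bar>" unfolding F_def x_def using m(2)[OF t] by (intro L(2)) auto
    then have "\<bar>y t\<bar> * \<bar>F t\<bar> \<le> \<bar>y t\<bar> * (L * \<bar>x t\<bar>)" by (rule mult_left_mono) simp
    then have "y t * F t \<le> \<bar>y t\<bar> * (L * \<bar>x t\<bar>)" using abs_ge_self[of "y t * F t"] unfolding abs_mult by linarith
    ultimately have "2 * x t * V t + 2 * y t * F t \<le> (1 + L) * (2 * \<bar>x t\<bar> * \<bar>y t\<bar>)"
      by (simp add: algebra_simps)
    also have "2 * \<bar>x t\<bar> * \<bar>y t\<bar> \<le> \<bar>x t\<bar>\<^sup>2 + \<bar>y t\<bar>\<^sup>2" by (rule sum_squares_bound)
    then have "(1 + L) * (2 * \<bar>x t\<bar> * \<bar>y t\<bar>) \<le> (1 + L) * (\<bar>x t\<bar>\<^sup>2 + \<bar>y t\<bar>\<^sup>2)"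
      using L(1) by (intro mult_left_mono) auto
    finally show "2 * x t * V t + 2 * y t * F t \<le> (1 + L) * u t"
      by (simp add: u_def)
  qed
  then show ?thesis by (simp add: u_def x_def sum_power2_eq_zero_iff)
qed

text \<open>Equal data have equal energy, so both solutions belong to the same system.\<close>

lemma future_solution_unique:
  assumes d: "d \<ge> 1" and g: "future_solution d t\<^sub>0 q g\<^sub>1" "future_solution d t\<^sub>0 q g\<^sub>2" and t: "t\<^sub>0 \<le> t"
  shows "g\<^sub>1 t = g\<^sub>2 t"
proof -
  obtain s\<^sub>1 where s1: "s\<^sub>1 < t\<^sub>0" "cmc_solution_on d {s\<^sub>1<..} g\<^sub>1" "(g\<^sub>1 t\<^sub>0, deriv g\<^sub>1 t\<^sub>0) = q"
    using g(1) unfolding future_solution_def by blast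
  obtain s\<^sub>2 where s2: "s\<^sub>2 < t\<^sub>0" "cmc_solution_on d {s\<^sub>2<..} g\<^sub>2" "(g\<^sub>2 t\<^sub>0, deriv g\<^sub>2 t\<^sub>0) = q"
    using g(2) unfolding future_solution_def by blast
  have eq: "g\<^sub>1 t\<^sub>0 = g\<^sub>2 t\<^sub>0" "deriv g\<^sub>1 t\<^sub>0 = deriv g\<^sub>2 t\<^sub>0" using s1(3) s2(3) by auto
  have "cmc_flow d (energy d (g\<^sub>2 t\<^sub>0) (deriv g\<^sub>2 t\<^sub>0)) {max s\<^sub>1 s\<^sub>2<..} g\<^sub>1 (\<lambda>t. lorentz g\<^sub>1 t * deriv g\<^sub>1 t)"
    by (rule cmc_flow_subset[OF cmc_solution_imp_flow[OF d s1(2,1), unfolded eq]]) simp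
  moreover have "cmc_flow d (energy d (g\<^sub>2 t\<^sub>0) (deriv g\<^sub>2 t\<^sub>0)) {max s\<^sub>1 s\<^sub>2<..} g\<^sub>2 (\<lambda>t. lorentz g\<^sub>2 t * deriv g\<^sub>2 t)"
    by (rule cmc_flow_subset[OF cmc_solution_imp_flow[OF d s2(2,1)]]) simp
  ultimately show ?thesis
    by (rule cmc_flow_unique_forward[OF _ _ _ _ _ t]) (use s1 s2 eq in \<open>auto simp: lorentz_def\<close>)
qed

section \<open>Global solutions tending to infinity\<close>

text \<open>The force is monotone in the radius and tends to \<open>1\<close> at infinity.\<close>

lemma force_bounds:
  assumes "0 < m" and "m \<le> r"
  shows "min 1 (force d E m) \<le> force d E r" and "force d E r \<le> max 1 (force d E m)"
proof -
  define k where "k = real d * E"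
  have f: "force d E x = 1 - k * (1 / x ^ Suc d)" for x by (simp add: force_def k_def)
  have le: "1 / r ^ Suc d \<le> 1 / m ^ Suc d"
    using assms by (intro divide_left_mono power_mono mult_pos_pos zero_less_power) auto
  have ge: "0 \<le> 1 / r ^ Suc d" using assms by simp
  show "min 1 (force d E m) \<le> force d E r" "force d E r \<le> max 1 (force d E m)"
  proof (atomize (full), cases "k \<ge> 0")
    case True
    then have "k * (1 / r ^ Suc d) \<le> k * (1 / m ^ Suc d)" "k * (1 / r ^ Suc d) \<ge> 0"
      using mult_left_mono[OF le True] mult_nonneg_nonneg[OF True ge] by blast+
    then have "force d E m \<le> force d E r" "force d E r \<le> 1" unfolding f by linarith+
    then show "min 1 (force d E m) \<le> force d E r \<and> force d E r \<le> max 1 (force d E m)" by simp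
  next
    case False
    then have k: "k \<le> 0" by simp
    have "k * (1 / m ^ Suc d) \<le> k * (1 / r ^ Suc d)" "k * (1 / r ^ Suc d) \<le> 0"
      using mult_left_mono_neg[OF le k] mult_nonpos_nonneg[OF k ge] by blast+
    then have "force d E r \<le> force d E m" "1 \<le> force d E r" unfolding f by linarith+
    then show "min 1 (force d E m) \<le> force d E r \<and> force d E r \<le> max 1 (force d E m)" by simp
  qed
qed

lemma continuous_on_truncated:
  fixes \<phi> :: "real \<Rightarrow> real"
  assumes "continuous_on {0<..} \<phi>" and "m > 0"
  shows "continuous_on UNIV (\<lambda>r. \<phi> (max r m))"
  by (rule continuous_on_compose2[OF assms(1)]) (use assms(2) in \<open>auto intro!: continuous_intros\<close>)

text \<open>Above the barrier \<open>m\<close> the level is strictly increasing, so the radius is a function \<open>h\<close> of the Lorentz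
  factor, and the momentum obeys the scalar equation \<open>p' = force (h (sqrt (1 + p\<^sup>2)))\<close>. Taking the
  momentum as the basic variable, rather than the radius, passes smoothly through a turning point,
  where \<open>p\<close> merely changes sign. Freezing the force below \<open>m\<close> makes both scalar equations defined on
  the whole line; as the level at \<open>m\<close> is below \<open>1\<close>, the solution never sees the frozen part.\<close>

lemma escape_over_barrier:
  assumes m: "0 < m" "m < a" and barrier: "level d E m < 1" "force d E m > 0"
    and p\<^sub>0: "sqrt (1 + p\<^sub>0\<^sup>2) = level d E a"
  shows "\<exists>g p. cmc_flow d E UNIV g p \<and> g t\<^sub>0 = a \<and> p t\<^sub>0 = p\<^sub>0 \<and> filterlim g at_top at_top"
proof -
  define \<Phi> where "\<Phi> r = force d E (max r m)" for r
  define c where "c = min 1 (force d E m)"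
  define C where "C = max 1 (force d E m)"
  have \<Phi>: "c \<le> \<Phi> r" "\<Phi> r \<le> C" for r
    using force_bounds[of m "max r m" d E] m by (simp_all add: \<Phi>_def c_def C_def)
  have c: "c > 0" using barrier by (simp add: c_def)
  have \<Phi>_pos: "\<Phi> r > 0" for r using \<Phi>(1)[of r] c by linarith
  have C: "C > 0" by (simp add: C_def)
  have cont\<Phi>: "continuous_on UNIV \<Phi>"
    unfolding \<Phi>_def[abs_def] by (rule continuous_on_truncated[OF continuous_on_force m(1)])
  have "continuous_on UNIV (\<lambda>r. 1 / \<Phi> r)"
    by (intro continuous_on_divide continuous_on_const cont\<Phi>) (use \<Phi>_pos in \<open>metis less_irrefl\<close>)
  \<comment> \<open>The inverse of the level as a solution of \<open>h' = 1 / force h\<close>.\<close>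
  then obtain h where h: "h (level d E a) = a" "\<And>y. (h has_real_derivative 1 / \<Phi> (h y)) (at y)"
    "strict_mono h" "filterlim h at_top at_top"
    by (rule autonomous_ode_between_constants[of "\<lambda>r. 1 / \<Phi> r" "1 / C" "1 / c" "level d E a" a])
      (use C c \<Phi> \<Phi>_pos in \<open>auto simp: frac_le\<close>)
  have h_cont: "continuous_on A h" for A
    using h(2) DERIV_isCont continuous_at_imp_continuous_on by blast
  have inverse_above: "level d E (h y\<^sub>2) - y\<^sub>2 = level d E (h y\<^sub>1) - y\<^sub>1" if y: "y\<^sub>1 < y\<^sub>2" "m \<le> h y\<^sub>1" for y\<^sub>1 y\<^sub>2
  proof -
    have ge: "h y \<ge> m" if "y \<ge> y\<^sub>1" for y
      using that y(2) strict_mono_less_eq[OF h(3)] by (meson order.trans)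
    have der: "((\<lambda>y. level d E (h y) - y) has_real_derivative 0) (at y)" if "y \<ge> y\<^sub>1" for y
    proof -
      have "((\<lambda>y. level d E (h y)) has_real_derivative force d E (h y) * (1 / \<Phi> (h y))) (at y)"
        by (rule DERIV_chain2[OF DERIV_level h(2)]) (use ge[OF that] m in linarith)
      moreover have "force d E (h y) * (1 / \<Phi> (h y)) = 1"
        using ge[OF that] \<Phi>_pos[of "h y"] by (simp add: \<Phi>_def max_absorb1)
      ultimately show ?thesis by (auto intro!: derivative_eq_intros)
    qed
    show ?thesis
      by (rule DERIV_isconst_end[OF y(1)])
        (use der in \<open>auto intro!: continuous_at_imp_continuous_on DERIV_isCont[OF der]\<close>)
  qed
  have hm: "h y > m" if "y \<ge> 1" for y
  proof (rule ccontr)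
    assume "\<not> h y > m"
    moreover have "y < level d E a"
      using strict_mono_less[OF h(3), of y "level d E a"] \<open>\<not> h y > m\<close> m(2) h(1) by simp
    ultimately obtain z where z: "y \<le> z" "z \<le> level d E a" "h z = m"
      using IVT'[of h y m "level d E a"] h(1) m(2) h_cont by auto
    have "z < level d E a" using z h(1) m(2) by (cases "z = level d E a") auto
    from inverse_above[OF this] have "z = level d E m" by (simp add: h(1) z(3))
    then show False using barrier(1) z(1) that by linarith
  qed
  have inv: "level d E (h y) = y" if "y \<ge> 1" for y
    using inverse_above[of y "level d E a"] inverse_above[of "level d E a" y] hm[OF that] m(2) h(1)
    by (cases y "level d E a" rule: linorder_cases) auto
  define w where "w p = sqrt (1 + p\<^sup>2)" for p :: real
  have w: "w p \<ge> 1" "w p > 0" for p by (auto simp: w_def add_pos_nonneg)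
  have dw: "(w has_real_derivative p / w p) (at p)" for p
  proof -
    have "1 + p\<^sup>2 > 0" by (simp add: add_pos_nonneg)
    then show ?thesis unfolding w_def by (auto intro!: derivative_eq_intros simp: field_simps)
  qed
  have "continuous_on UNIV (\<lambda>p. \<Phi> (h (w p)))"
    by (intro continuous_on_compose2[OF cont\<Phi>] continuous_on_compose2[OF h_cont[of UNIV]])
      (auto simp: w_def[abs_def] intro!: continuous_intros)
  then obtain p where p: "p t\<^sub>0 = p\<^sub>0" "\<And>t. (p has_real_derivative \<Phi> (h (w (p t)))) (at t)"
    "filterlim p at_top at_top"
    by (rule autonomous_ode_between_constants[of _ c C t\<^sub>0 p\<^sub>0]) (use c \<Phi> in auto)
  define g where "g t = h (w (p t))" for t
  have gm: "g t > m" for t using hm w(1) by (simp add: g_def)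
  have "(g has_real_derivative 1 / \<Phi> (g t) * (p t / w (p t) * \<Phi> (g t))) (at t)" for t
    unfolding g_def by (rule DERIV_chain2[OF h(2) DERIV_chain2[OF dw p(2)]])
  moreover have "1 / \<Phi> (g t) * (p t / w (p t) * \<Phi> (g t)) = p t / w (p t)" for t
    using \<Phi>_pos[of "g t"] by (simp add: field_simps)
  ultimately have dg: "(g has_real_derivative p t / w (p t)) (at t)" for t by metis
  have "cmc_flow d E UNIV g p"
    unfolding cmc_flow_def w_def[symmetric]
  proof (intro ballI conjI)
    fix t
    show "g t > 0" using gm[of t] m by linarith
    show "(g has_real_derivative p t / w (p t)) (at t)" by (rule dg)
    have "\<Phi> (g t) = force d E (g t)" using gm[of t] by (simp add: \<Phi>_def max_absorb1)
    then show "(p has_real_derivative force d E (g t)) (at t)" using p(2)[of t] by (simp add: g_def)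
    show "w (p t) = level d E (g t)" using inv[OF w(1)] by (simp add: g_def)
  qed
  moreover have "g t\<^sub>0 = a" using p\<^sub>0 by (simp add: g_def p(1) w_def h(1))
  moreover have "filterlim g at_top at_top"
  proof -
    have "filterlim (\<lambda>t. w (p t)) at_top at_top"
      by (rule filterlim_at_top_mono[OF p(3)]) (auto simp: w_def intro!: always_eventually real_le_rsqrt)
    then show ?thesis unfolding g_def by (rule filterlim_compose[OF h(4)])
  qed
  ultimately show ?thesis using p(1) by blast
qed

text \<open>As the level stays away from \<open>1\<close>, the velocity stays away from \<open>0\<close>, and the energy identity solved for
  the velocity is itself a scalar equation for the radius. It is made global by freezing its right-hand
  side below \<open>m\<close>; since the radius increases, it satisfies the true equation from some time before
  \<open>t\<^sub>0\<close> onwards.\<close>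

lemma escape_without_turning:
  assumes m: "0 < m" "m < a" and \<delta>: "\<delta> > 0" "\<And>r. r \<ge> m \<Longrightarrow> 1 + \<delta> \<le> level d E r"
    and p\<^sub>0: "sqrt (1 + p\<^sub>0\<^sup>2) = level d E a" "p\<^sub>0 > 0"
  shows "\<exists>s<t\<^sub>0. \<exists>g p. cmc_flow d E {s<..} g p \<and> g t\<^sub>0 = a \<and> p t\<^sub>0 = p\<^sub>0 \<and> filterlim g at_top at_top"
proof -
  define G where "G = level d E"
  define P where "P r = sqrt ((G r)\<^sup>2 - 1)" for r
  define V where "V r = P (max r m) / G (max r m)" for r
  have G: "G r \<ge> 1 + \<delta>" "G r > 0" "(G r)\<^sup>2 - 1 > 0" if "r \<ge> m" for r
  proof -
    show G: "G r \<ge> 1 + \<delta>" using \<delta>(2)[OF that] by (simp add: G_def)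
    then show "G r > 0" using \<delta>(1) by linarith
    have "1\<^sup>2 < (G r)\<^sup>2" using G \<delta>(1) by (intro power_strict_mono) auto
    then show "(G r)\<^sup>2 - 1 > 0" by simp
  qed
  have P: "P r > 0" "1 + (P r)\<^sup>2 = (G r)\<^sup>2" if "r \<ge> m" for r
    using G(3)[OF that] by (auto simp: P_def)
  define c where "c = sqrt (1 - 1 / (1 + \<delta>)\<^sup>2)"
  have V_eq: "V r = sqrt (1 - 1 / (G (max r m))\<^sup>2)" for r
  proof -
    have "1 - 1 / (G (max r m))\<^sup>2 = ((G (max r m))\<^sup>2 - 1) / (G (max r m))\<^sup>2"
      using G(2)[of "max r m"] by (simp add: diff_divide_distrib)
    then show ?thesis using G(2)[of "max r m"] by (simp add: V_def P_def real_sqrt_divide)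
  qed
  have "1\<^sup>2 < (1 + \<delta>)\<^sup>2" using \<delta>(1) by (intro power_strict_mono) auto
  then have "1 / (1 + \<delta>)\<^sup>2 < 1" by (subst divide_less_eq_1_pos) auto
  then have c: "c > 0" by (simp add: c_def)
  have V: "c \<le> V r" "V r \<le> 1" for r
  proof -
    have "1 / (G (max r m))\<^sup>2 \<le> 1 / (1 + \<delta>)\<^sup>2"
      using G(1)[of "max r m"] \<delta>(1) by (intro divide_left_mono power_mono mult_pos_pos) auto
    then show "c \<le> V r" unfolding V_eq c_def by simp
    show "V r \<le> 1" unfolding V_eq by (simp add: real_sqrt_le_1_iff)
  qed
  have contG: "continuous_on {m..} G"
    unfolding G_def by (rule continuous_on_subset[OF continuous_on_level]) (use m in auto)
  have "continuous_on {m..} (\<lambda>r. P r / G r)"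
    unfolding P_def by (intro continuous_intros contG) (use G(2) in force)
  then have "continuous_on UNIV V"
    unfolding V_def by (rule continuous_on_compose2) (auto intro!: continuous_intros)
  then obtain g where g: "g t\<^sub>0 = a" "\<And>t. (g has_real_derivative V (g t)) (at t)"
    "strict_mono g" "filterlim g at_top at_top"
    by (rule autonomous_ode_between_constants[of V c 1 t\<^sub>0 a]) (use c V in auto)
  have "(g \<longlongrightarrow> g t\<^sub>0) (at_left t\<^sub>0)"
    using DERIV_isCont[OF g(2)] by (simp add: isCont_def filterlim_at_split)
  then have "\<forall>\<^sub>F t in at_left t\<^sub>0. g t > m"
    using m(2) g(1) by (simp add: order_tendstoD)
  then obtain s where s: "s < t\<^sub>0" "g s > m"
    by (metis eventually_at_left_field eventually_happens' trivial_limit_at_left_real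
        dense eventually_at_left_real)
  have gm: "g t > m" if "t > s" for t
    using strict_mono_less[OF g(3)] that s(2) by (meson less_trans)
  define p where "p t = P (g t)" for t
  have w: "sqrt (1 + (p t)\<^sup>2) = G (g t)" if "t > s" for t
    using P(2)[of "g t"] G(2)[of "g t"] gm[OF that] by (simp add: p_def)
  have "cmc_flow d E {s<..} g p"
    unfolding cmc_flow_def
  proof (intro ballI conjI)
    fix t assume "t \<in> {s<..}"
    then have t: "t > s" by simp
    then have gt: "g t \<ge> m" and g0: "g t > 0" using gm m by (force, force dest: gm)
    show "g t > 0" by (rule g0)
    have Vg: "V (g t) = p t / G (g t)" using gt by (simp add: V_def p_def max_absorb1)
    show "(g has_real_derivative p t / sqrt (1 + (p t)\<^sup>2)) (at t)"
      unfolding w[OF t] using g(2)[of t] Vg by simp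
    have "((\<lambda>t. G (g t)) has_real_derivative force d E (g t) * V (g t)) (at t)"
      unfolding G_def by (rule DERIV_chain2[OF DERIV_level[OF g0] g(2)])
    then have "(p has_real_derivative
        (2 * G (g t) * (force d E (g t) * V (g t))) * (inverse (P (g t)) / 2)) (at t)"
      unfolding p_def P_def using G(3)[OF gt]
      by (auto intro!: derivative_eq_intros)
    also have "(2 * G (g t) * (force d E (g t) * V (g t))) * (inverse (P (g t)) / 2) = force d E (g t)"
      using P(1)[OF gt] G(2)[OF gt] by (simp add: Vg p_def field_simps)
    finally show "(p has_real_derivative force d E (g t)) (at t)" .
    show "sqrt (1 + (p t)\<^sup>2) = level d E (g t)" using w[OF t] by (simp add: G_def)
  qed
  moreover have "p t\<^sub>0 = p\<^sub>0"
  proof -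
    have "(G a)\<^sup>2 - 1 = p\<^sub>0\<^sup>2"
      using p\<^sub>0(1) by (simp add: G_def[symmetric]) (metis add_diff_cancel_left' add_nonneg_nonneg real_sqrt_pow2 zero_le_one zero_le_power2)
    then show ?thesis using p\<^sub>0(2) by (simp add: p_def P_def g(1))
  qed
  ultimately show ?thesis using s(1) g(1,4) by blast
qed

section \<open>Data leading to infinity\<close>

text \<open>The alternatives are the hypotheses of \<open>escape_over_barrier\<close> and \<open>escape_without_turning\<close>. The witness
  \<open>m\<close> lies strictly below the initial radius so that it survives a perturbation of the data.\<close>

definition escaping :: "nat \<Rightarrow> real \<Rightarrow> real \<Rightarrow> bool" where
  "escaping d a v \<longleftrightarrow> (let E = energy d a v in
     \<exists>m. 0 < m \<and> m < a \<and>
       (level d E m < 1 \<and> force d E m > 0 \<or> v > 0 \<and> (\<exists>\<delta>>0. \<forall>r\<ge>m. 1 + \<delta> \<le> level d E r)))"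

lemma level_energy:
  assumes "a > 0"
  shows "level d (energy d a v) a = 1 / sqrt (1 - v\<^sup>2)"
  using assms by (simp add: level_def energy_def)

lemma escaping_imp_future_solution:
  assumes a: "a > 0" and v: "\<bar>v\<bar> < 1" and esc: "escaping d a v"
  obtains g where "future_solution d t\<^sub>0 (a, v) g" and "filterlim g at_top at_top"
proof -
  define E where "E = energy d a v"
  define k where "k = 1 / sqrt (1 - v\<^sup>2)"
  have v2: "1 - v\<^sup>2 > 0" using v by (simp add: abs_square_less_1)
  then have k: "k > 0" "k\<^sup>2 * (1 - v\<^sup>2) = 1" by (simp_all add: k_def power_divide)
  then have "1 + (k * v)\<^sup>2 = k\<^sup>2" by (simp add: power_mult_distrib algebra_simps)
  then have w: "sqrt (1 + (k * v)\<^sup>2) = k" using k by simp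
  then have p0: "sqrt (1 + (k * v)\<^sup>2) = level d E a" using level_energy[OF a] by (simp add: E_def k_def)
  obtain m where m: "0 < m" "m < a"
    "level d E m < 1 \<and> force d E m > 0 \<or> v > 0 \<and> (\<exists>\<delta>>0. \<forall>r\<ge>m. 1 + \<delta> \<le> level d E r)"
    using esc unfolding escaping_def E_def Let_def by blast
  have "\<exists>s<t\<^sub>0. \<exists>g p. cmc_flow d E {s<..} g p \<and> g t\<^sub>0 = a \<and> p t\<^sub>0 = k * v \<and> filterlim g at_top at_top"
    using m(3)
  proof
    assume "level d E m < 1 \<and> force d E m > 0"
    then show ?thesis
      using escape_over_barrier[OF m(1,2) _ _ p0, of t\<^sub>0] cmc_flow_subset[of d E UNIV _ _ "{t\<^sub>0 - 1<..}"]
      by (intro exI[of _ "t\<^sub>0 - 1"]) fastforce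
  next
    assume "v > 0 \<and> (\<exists>\<delta>>0. \<forall>r\<ge>m. 1 + \<delta> \<le> level d E r)"
    then show ?thesis
      using escape_without_turning[OF m(1,2) _ _ p0] k(1) by auto
  qed
  then obtain s g p where s: "s < t\<^sub>0" and flow: "cmc_flow d E {s<..} g p"
    and g: "g t\<^sub>0 = a" "p t\<^sub>0 = k * v" "filterlim g at_top at_top" by blast
  have "deriv g t\<^sub>0 = v"
    using cmc_flow_imp_solution(2)[OF _ flow, of t\<^sub>0] s k(1) by (simp add: g(2) w)
  then have "future_solution d t\<^sub>0 (a, v) g"
    unfolding future_solution_def using s cmc_flow_imp_solution(1)[OF _ flow] g(1) by auto
  then show ?thesis using that g(3) by blast
qed

text \<open>The energy depends continuously on the data. At fixed \<open>m\<close> the barrier condition is a strict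
  inequality at a single radius; in the other case a change of \<open>E\<close> by \<open>\<delta> / 2 * m ^ d\<close> moves the level
  by at most \<open>\<delta> / 2\<close> at all radii beyond \<open>m\<close>.\<close>

lemma eventually_escaping:
  assumes a: "a > 0" and v: "\<bar>v\<bar> < 1" and esc: "escaping d a v"
  shows "\<forall>\<^sub>F q in nhds (a, v). escaping d (fst q) (snd q)"
proof -
  let ?N = "nhds (a, v)" and ?E = "\<lambda>q. energy d (fst q) (snd q)"
  define E where "E = energy d a v"
  have v2: "1 - v\<^sup>2 > 0" using v by (simp add: abs_square_less_1)
  have id: "((\<lambda>q. q) \<longlongrightarrow> (a, v)) ?N" by (simp add: filterlim_ident)
  have fst: "(fst \<longlongrightarrow> a) ?N" and snd: "(snd \<longlongrightarrow> v) ?N"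
    using tendsto_fst[OF id] tendsto_snd[OF id] by simp_all
  have EE: "(?E \<longlongrightarrow> E) ?N"
    unfolding E_def energy_def by (intro tendsto_intros fst snd) (use v2 in auto)
  obtain m where m: "0 < m" "m < a"
    "level d E m < 1 \<and> force d E m > 0 \<or> v > 0 \<and> (\<exists>\<delta>>0. \<forall>r\<ge>m. 1 + \<delta> \<le> level d E r)"
    using esc unfolding escaping_def E_def Let_def by blast
  have ma: "\<forall>\<^sub>F q in ?N. m < fst q" using order_tendstoD(1)[OF fst m(2)] .
  show ?thesis
    using m(3)
  proof
    assume b: "level d E m < 1 \<and> force d E m > 0"
    have "((\<lambda>q. level d (?E q) m) \<longlongrightarrow> level d E m) ?N" "((\<lambda>q. force d (?E q) m) \<longlongrightarrow> force d E m) ?N"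
      unfolding level_def force_def by (intro tendsto_intros EE; use m(1) in simp)+
    then have "\<forall>\<^sub>F q in ?N. level d (?E q) m < 1" "\<forall>\<^sub>F q in ?N. force d (?E q) m > 0"
      using b order_tendstoD by blast+
    with ma show ?thesis
      by eventually_elim (use m(1) in \<open>auto simp: escaping_def Let_def\<close>)
  next
    assume "v > 0 \<and> (\<exists>\<delta>>0. \<forall>r\<ge>m. 1 + \<delta> \<le> level d E r)"
    then obtain \<delta> where v0: "v > 0" and \<delta>: "\<delta> > 0" "\<And>r. r \<ge> m \<Longrightarrow> 1 + \<delta> \<le> level d E r" by blast
    have "\<forall>\<^sub>F q in ?N. snd q > 0" using order_tendstoD(1)[OF snd v0] .
    moreover have "\<forall>\<^sub>F q in ?N. ?E q > E - \<delta> / 2 * m ^ d"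
      by (rule order_tendstoD(1)[OF EE]) (use \<delta>(1) m(1) in simp)
    ultimately show ?thesis
      using ma
    proof eventually_elim
      case (elim q)
      have "1 + \<delta> / 2 \<le> level d (?E q) r" if "r \<ge> m" for r
      proof -
        have r: "r > 0" using that m(1) by linarith
        have "m ^ d \<le> r ^ d" using that m(1) by (intro power_mono) auto
        then have "\<delta> / 2 * m ^ d \<le> \<delta> / 2 * r ^ d" using \<delta>(1) by (intro mult_left_mono) auto
        then have "E - \<delta> / 2 * r ^ d \<le> ?E q" using elim by linarith
        then have "(E - \<delta> / 2 * r ^ d) / r ^ d \<le> ?E q / r ^ d" using r by (intro divide_right_mono) auto
        then have "E / r ^ d - \<delta> / 2 \<le> ?E q / r ^ d" using r by (simp add: diff_divide_distrib)
        then show ?thesis using \<delta>(2)[OF that] by (simp add: level_def)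
      qed
      then show ?case
        unfolding escaping_def Let_def using elim m(1) \<delta>(1) half_gt_zero by blast
    qed
  qed
qed

text \<open>The constant solution has the same phase-space position at time \<open>t\<close>, so uniqueness would make the
  flow constant from then on.\<close>

lemma no_equilibrium_of_unbounded_flow:
  assumes flow: "cmc_flow d E {s<..} g p" and g: "filterlim g at_top at_top"
    and t: "t > s" "p t = 0" "force d E (g t) = 0"
  shows False
proof -
  have "cmc_flow d E {s<..} (\<lambda>_. g t) (\<lambda>_. 0)"
    using cmc_flowD[OF flow, of t] t by (auto simp: cmc_flow_def)
  then have const: "g b = g t" if "t \<le> b" for b
    using cmc_flow_unique_forward[where g\<^sub>2="\<lambda>_. g t" and p\<^sub>2="\<lambda>_. 0", OF flow _ t(1) refl t(2) that]
    by blast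
  have "\<forall>\<^sub>F b in at_top. g b > g t" using g by (simp add: filterlim_at_top_dense)
  then have "\<forall>\<^sub>F b :: real in at_top. False"
    using eventually_ge_at_top[of t]
  proof eventually_elim
    case (elim b)
    then show ?case using const[of b] by linarith
  qed
  then show False by simp
qed

text \<open>Let \<open>r\<^sub>1\<close> be the minimal radius after \<open>t\<^sub>0\<close>, attained at \<open>t\<^sub>1\<close>. The solution sweeps out all radii beyond
  \<open>r\<^sub>1\<close>, so the level is at least \<open>1\<close> there. If the momentum vanishes at \<open>t\<^sub>1\<close>, the level is \<open>1\<close> at \<open>r\<^sub>1\<close>
  and cannot have derivative \<open>\<le> 0\<close>: a negative one contradicts the bound and zero is an equilibrium;
  so there is a barrier just below \<open>r\<^sub>1\<close>. Otherwise the minimum is at \<open>t\<^sub>0\<close> with positive velocity, and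
  the level is even above \<open>1\<close> beyond \<open>r\<^sub>1\<close>: a radius of level \<open>1\<close> would be an interior minimum of the
  level, hence again an equilibrium. Compactness gives the uniform gap.\<close>

lemma unbounded_solution_escaping:
  assumes d: "d \<ge> 1" and sol: "cmc_solution_on d {s<..} f" and t\<^sub>0: "t\<^sub>0 > s"
    and f: "filterlim f at_top at_top"
  shows "escaping d (f t\<^sub>0) (deriv f t\<^sub>0)"
proof -
  define E where "E = energy d (f t\<^sub>0) (deriv f t\<^sub>0)"
  define p where "p t = lorentz f t * deriv f t" for t
  have flow: "cmc_flow d E {s<..} f p"
    using cmc_solution_imp_flow[OF d sol t\<^sub>0] by (simp add: E_def p_def[abs_def])
  have pos: "f t > 0" and w: "sqrt (1 + (p t)\<^sup>2) = level d E (f t)"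
    and df: "(f has_real_derivative p t / sqrt (1 + (p t)\<^sup>2)) (at t)"
    and dp: "(p has_real_derivative force d E (f t)) (at t)" if "t > s" for t
    using cmc_flowD[OF flow, of t] that by auto
  have lor: "lorentz f t\<^sub>0 > 0"
    using sol t\<^sub>0 by (intro lorentz_pos) (auto simp: cmc_solution_on_def)
  have contf: "continuous_on A f" if "A \<subseteq> {s<..}" for A
    using that df DERIV_isCont by (blast intro: continuous_at_imp_continuous_on)
  have cont_level: "isCont (level d E) r" if "r > 0" for r
    using DERIV_isCont[OF DERIV_level[OF that]] .
  obtain b where b: "b \<ge> t\<^sub>0" "\<And>t. t \<ge> b \<Longrightarrow> f t \<ge> f t\<^sub>0"
  proof -
    have "\<forall>\<^sub>F t in at_top. f t \<ge> f t\<^sub>0 \<and> t \<ge> t\<^sub>0"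
      using f eventually_ge_at_top[of t\<^sub>0] by (simp add: filterlim_at_top eventually_conj)
    then obtain b where "\<forall>t\<ge>b. f t \<ge> f t\<^sub>0 \<and> t \<ge> t\<^sub>0" unfolding eventually_at_top_linorder by blast
    then show ?thesis using that[of b] by blast
  qed
  obtain t\<^sub>1 where t1: "t\<^sub>1 \<ge> t\<^sub>0" "\<And>t. t \<ge> t\<^sub>0 \<Longrightarrow> f t\<^sub>1 \<le> f t"
  proof -
    have "{t\<^sub>0..b} \<noteq> {}" "continuous_on {t\<^sub>0..b} f"
      using b(1) t\<^sub>0 by (auto intro!: contf)
    from continuous_attains_inf[OF compact_Icc this]
    obtain t\<^sub>1 where t1: "t\<^sub>1 \<in> {t\<^sub>0..b}" "\<And>t. t \<in> {t\<^sub>0..b} \<Longrightarrow> f t\<^sub>1 \<le> f t" by blast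
    have "f t\<^sub>1 \<le> f t" if "t \<ge> t\<^sub>0" for t
    proof (cases "t \<le> b")
      case False
      then have "f t\<^sub>0 \<le> f t" using b(2) by simp
      moreover have "f t\<^sub>1 \<le> f t\<^sub>0" using t1(2) b(1) by simp
      ultimately show ?thesis by linarith
    qed (use t1(2) that in simp)
    moreover have "t\<^sub>1 \<ge> t\<^sub>0" using t1(1) by simp
    ultimately show ?thesis using that by blast
  qed
  define r\<^sub>1 where "r\<^sub>1 = f t\<^sub>1"
  have t1s: "t\<^sub>1 > s" using t1 t\<^sub>0 by linarith
  have r1: "r\<^sub>1 > 0" "r\<^sub>1 \<le> f t\<^sub>0" using pos[OF t1s] t1(2)[of t\<^sub>0] by (simp_all add: r\<^sub>1_def)
  have reach: "\<exists>t\<ge>t\<^sub>1. f t = r" if r: "r \<ge> r\<^sub>1" for r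
  proof -
    have "\<forall>\<^sub>F t in at_top. f t \<ge> r \<and> t \<ge> t\<^sub>1"
      using f eventually_ge_at_top[of t\<^sub>1] by (simp add: filterlim_at_top eventually_conj)
    then obtain b where "\<forall>t\<ge>b. f t \<ge> r \<and> t \<ge> t\<^sub>1" unfolding eventually_at_top_linorder by blast
    then have "b \<ge> t\<^sub>1" "f b \<ge> r" by blast+
    then show ?thesis
      using IVT'[of f t\<^sub>1 r b] r contf[of "{t\<^sub>1..b}"] t1s by (force simp: r\<^sub>1_def)
  qed
  have level_ge: "level d E r \<ge> 1" if r: "r \<ge> r\<^sub>1" for r
  proof -
    obtain t where t: "t \<ge> t\<^sub>1" "f t = r" using reach[OF r] by blast
    have "1 \<le> sqrt (1 + (p t)\<^sup>2)" by simp
    also have "\<dots> = level d E r" using w[of t] t t1s by simp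
    finally show ?thesis .
  qed
  have level_1: "p t = 0" if "t > s" "level d E (f t) = 1" for t
    using w[OF that(1)] that(2) by simp
  show ?thesis
  proof (cases "p t\<^sub>1 = 0")
    case True
    then have l1: "level d E r\<^sub>1 = 1" using w[OF t1s] by (simp add: r\<^sub>1_def)
    have "\<not> force d E r\<^sub>1 < 0"
    proof
      assume "force d E r\<^sub>1 < 0"
      from DERIV_neg_dec_right[OF DERIV_level[OF r1(1)] this]
      obtain e where e: "e > 0" "\<And>h. h > 0 \<Longrightarrow> h < e \<Longrightarrow> level d E (r\<^sub>1 + h) < level d E r\<^sub>1" by blast
      have "level d E (r\<^sub>1 + e / 2) < level d E r\<^sub>1" by (rule e(2)) (use e(1) in auto)
      moreover have "level d E (r\<^sub>1 + e / 2) \<ge> 1" by (rule level_ge) (use e(1) in simp)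
      ultimately show False using l1 by linarith
    qed
    moreover have "force d E r\<^sub>1 \<noteq> 0"
      using no_equilibrium_of_unbounded_flow[OF flow f t1s True] by (auto simp: r\<^sub>1_def)
    ultimately have F: "force d E r\<^sub>1 > 0" by linarith
    from DERIV_pos_inc_left[OF DERIV_level[OF r1(1)] this]
    obtain e where e: "e > 0" "\<And>h. h > 0 \<Longrightarrow> h < e \<Longrightarrow> level d E (r\<^sub>1 - h) < 1" using l1 by auto
    have "isCont (force d E) r\<^sub>1"
      using continuous_on_force r1(1) by (simp add: continuous_on_eq_continuous_at)
    then have "\<forall>\<^sub>F r in at r\<^sub>1. force d E r > 0"
      using F by (simp add: isCont_def order_tendstoD)
    then obtain e' where e': "e' > 0" "\<And>r. r \<noteq> r\<^sub>1 \<Longrightarrow> dist r r\<^sub>1 < e' \<Longrightarrow> force d E r > 0"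
      unfolding eventually_at by auto
    define h where "h = min (min e e') r\<^sub>1 / 2"
    have h: "h > 0" "h < e" "h < e'" "h < r\<^sub>1" using e(1) e'(1) r1(1) by (auto simp: h_def min_def)
    have "level d E (r\<^sub>1 - h) < 1" "force d E (r\<^sub>1 - h) > 0" "0 < r\<^sub>1 - h" "r\<^sub>1 - h < f t\<^sub>0"
      using e(2)[of h] e'(2)[of "r\<^sub>1 - h"] h r1(2) by (auto simp: dist_real_def)
    then show ?thesis unfolding escaping_def E_def[symmetric] Let_def by blast
  next
    case False
    have df1: "(f has_real_derivative p t\<^sub>1 / sqrt (1 + (p t\<^sub>1)\<^sup>2)) (at t\<^sub>1)" by (rule df[OF t1s])
    have w1: "sqrt (1 + (p t\<^sub>1)\<^sup>2) > 0" by (simp add: add_pos_nonneg)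
    have "\<not> t\<^sub>1 > t\<^sub>0"
    proof
      assume "t\<^sub>1 > t\<^sub>0"
      then have "p t\<^sub>1 / sqrt (1 + (p t\<^sub>1)\<^sup>2) = 0"
        using DERIV_local_min[OF df1, of "t\<^sub>1 - t\<^sub>0"] t1(2) by auto
      then show False using False w1 by simp
    qed
    then have t10: "t\<^sub>1 = t\<^sub>0" using t1(1) by simp
    have "\<not> p t\<^sub>1 < 0"
    proof
      assume "p t\<^sub>1 < 0"
      then have "p t\<^sub>1 / sqrt (1 + (p t\<^sub>1)\<^sup>2) < 0" using w1 by (simp add: divide_neg_pos)
      from DERIV_neg_dec_right[OF df1 this]
      obtain e where "e > 0" "\<And>h. h > 0 \<Longrightarrow> h < e \<Longrightarrow> f (t\<^sub>1 + h) < f t\<^sub>1" by blast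
      then have "f (t\<^sub>1 + e / 2) < f t\<^sub>1" by simp
      then show False using t1(2)[of "t\<^sub>1 + e / 2"] t1(1) \<open>e > 0\<close> by simp
    qed
    then have p1: "p t\<^sub>1 > 0" using False by linarith
    then have v: "deriv f t\<^sub>0 > 0" using lor by (simp add: p_def t10 zero_less_mult_iff)
    have gt1: "level d E r > 1" if r: "r \<ge> r\<^sub>1" for r
    proof (rule ccontr)
      assume "\<not> level d E r > 1"
      then have l: "level d E r = 1" using level_ge[OF r] by linarith
      obtain t where t: "t \<ge> t\<^sub>1" "f t = r" using reach[OF r] by blast
      have pt: "p t = 0" using level_1[of t] t l t1s by simp
      have "level d E r\<^sub>1 \<noteq> 1" using level_1[OF t1s] False by (auto simp: r\<^sub>1_def)
      then have rr: "r > r\<^sub>1" using r l by (cases "r = r\<^sub>1") auto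
      have "force d E r = 0"
      proof (rule DERIV_local_min)
        show "(level d E has_real_derivative force d E r) (at r)" using DERIV_level rr r1(1) by simp
        show "0 < r - r\<^sub>1" using rr by simp
        show "\<forall>y. \<bar>r - y\<bar> < r - r\<^sub>1 \<longrightarrow> level d E r \<le> level d E y"
          using level_ge l by auto
      qed
      then show False using no_equilibrium_of_unbounded_flow[OF flow f, of t] pt t t1s by auto
    qed
    \<comment> \<open>Beyond \<open>R\<close> the level is at least \<open>2\<close>, because \<open>\<bar>E / r ^ d\<bar> \<le> \<bar>E\<bar>\<close> for \<open>r \<ge> 1\<close>.\<close>
    define R where "R = max (2 + \<bar>E\<bar>) r\<^sub>1"
    have "continuous_on {r\<^sub>1..R} (level d E)"
      by (rule continuous_on_subset[OF continuous_on_level]) (use r1(1) in auto)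
    from continuous_attains_inf[OF compact_Icc _ this]
    obtain r\<^sub>2 where r2: "r\<^sub>2 \<in> {r\<^sub>1..R}" "\<And>r. r \<in> {r\<^sub>1..R} \<Longrightarrow> level d E r\<^sub>2 \<le> level d E r"
      by (auto simp: R_def)
    define \<delta> where "\<delta> = min 1 (level d E r\<^sub>2 - 1)"
    have \<delta>: "\<delta> > 0" using gt1[of r\<^sub>2] r2(1) by (simp add: \<delta>_def)
    have above: "level d E r \<ge> 1 + \<delta>" if "r \<ge> r\<^sub>1" for r
    proof (cases "r \<le> R")
      case True
      then show ?thesis using r2(2)[of r] that by (auto simp: \<delta>_def)
    next
      case False
      then have r: "r \<ge> 2 + \<bar>E\<bar>" by (simp add: R_def)
      then have rd: "r ^ d \<ge> 1" by (intro one_le_power) simp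
      then have "\<bar>E\<bar> / r ^ d \<le> \<bar>E\<bar> / 1" by (intro divide_left_mono) auto
      moreover have "\<bar>E / r ^ d\<bar> = \<bar>E\<bar> / r ^ d" using rd by (simp add: abs_divide)
      ultimately have "level d E r \<ge> 2" using r unfolding level_def by linarith
      then show ?thesis by (simp add: \<delta>_def)
    qed
    have "\<forall>\<^sub>F r in at r\<^sub>1. level d E r > 1 + \<delta> / 2"
      using cont_level[OF r1(1)] above[of r\<^sub>1] \<delta> by (intro order_tendstoD(1)) (auto simp: isCont_def)
    then obtain e where e: "e > 0" "\<And>r. r \<noteq> r\<^sub>1 \<Longrightarrow> dist r r\<^sub>1 < e \<Longrightarrow> level d E r > 1 + \<delta> / 2"
      unfolding eventually_at by auto
    define m where "m = r\<^sub>1 - min e r\<^sub>1 / 2"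
    have m: "0 < m" "m < r\<^sub>1" "r\<^sub>1 - m < e" using e(1) r1(1) by (auto simp: m_def min_def)
    have "1 + \<delta> / 2 \<le> level d E r" if "r \<ge> m" for r
    proof (cases "r < r\<^sub>1")
      case True
      then show ?thesis using e(2)[of r] m(3) that by (simp add: dist_real_def)
    next
      case False
      then show ?thesis using above[of r] \<delta> by simp
    qed
    moreover have "m < f t\<^sub>0" using m(2) r1(2) by linarith
    ultimately show ?thesis
      unfolding escaping_def E_def[symmetric] Let_def using m(1) v \<delta> half_gt_zero by blast
  qed
qed

section \<open>Asymptotic drift of unbounded solutions\<close>

text \<open>Eventually the Lorentz factor is at least \<open>max (g / 2) 2\<close>. So the momentum no longer vanishes, it
  must be positive since the radius grows, and the velocity \<open>x\<close> satisfies \<open>x \<ge> x\<^sup>2 = 1 - 1 / w\<^sup>2\<close>.\<close>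

lemma velocity_deficit:
  assumes d: "d \<ge> 1" and sol: "cmc_solution_on d {s<..} g" and g: "filterlim g at_top at_top"
  obtains T where "T > s" and "\<And>t. t \<ge> T \<Longrightarrow> 1 / 2 \<le> deriv g t \<and> 1 - 4 / (g t)\<^sup>2 \<le> deriv g t"
proof -
  define E where "E = energy d (g (s + 1)) (deriv g (s + 1))"
  define p where "p t = lorentz g t * deriv g t" for t
  define w where "w t = sqrt (1 + (p t)\<^sup>2)" for t
  have flow: "cmc_flow d E {s<..} g p"
    using cmc_solution_imp_flow[OF d sol, of "s + 1"] by (simp add: E_def p_def[abs_def])
  note F = cmc_flowD[OF flow, folded w_def]
  have dg: "deriv g t = p t / w t" if "t > s" for t
    using cmc_flow_imp_solution(2)[OF _ flow, of t] that by (simp add: w_def)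
  have "((\<lambda>r::real. E / r ^ d) \<longlongrightarrow> 0) at_top"
    by (rule real_tendsto_divide_at_top[OF tendsto_const]) (use d in \<open>simp add: filterlim_pow_at_top filterlim_ident\<close>)
  then have "((\<lambda>t. E / g t ^ d) \<longlongrightarrow> 0) at_top" using g by (rule filterlim_compose)
  then have "\<forall>\<^sub>F t in at_top. E / g t ^ d > - 1" by (rule order_tendstoD) simp
  moreover have "\<forall>\<^sub>F t in at_top. g t \<ge> 4" using g by (simp add: filterlim_at_top)
  ultimately have "\<forall>\<^sub>F t in at_top. E / g t ^ d > - 1 \<and> g t \<ge> 4 \<and> t > s"
    using eventually_gt_at_top[of s] by eventually_elim simp
  then obtain T where T: "\<And>t. t \<ge> T \<Longrightarrow> E / g t ^ d > - 1 \<and> g t \<ge> 4 \<and> t > s"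
    unfolding eventually_at_top_linorder by blast
  have Ts: "T > s" using T by blast
  have w_large: "w t \<ge> g t / 2" "w t \<ge> 2" if "t \<ge> T" for t
    using T[OF that] F(4)[of t] by (auto simp: level_def)
  have p_nz: "p t \<noteq> 0" if "t \<ge> T" for t
    using w_large(2)[OF that] by (auto simp: w_def)
  have p_pos: "p t > 0" if t: "t \<ge> T" for t
  proof (rule ccontr)
    assume "\<not> p t > 0"
    then have pt: "p t < 0" using p_nz[OF t] by linarith
    have neg: "p b < 0" if b: "b \<ge> t" for b
    proof (rule ccontr)
      assume "\<not> p b < 0"
      moreover have "\<forall>x. t \<le> x \<and> x \<le> b \<longrightarrow> isCont p x"
        using F(3) T t DERIV_isCont by (metis greaterThan_iff order.trans)
      ultimately obtain x where "t \<le> x" "p x = 0"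
        using IVT[of p t 0 b] pt b by auto
      then show False using p_nz[of x] t by simp
    qed
    have le: "g b \<le> g t" if b: "b \<ge> t" for b
    proof (rule DERIV_nonpos_imp_nonincreasing[OF b], intro exI conjI)
      fix x assume x: "t \<le> x" "x \<le> b"
      show "(g has_real_derivative p x / w x) (at x)" using F(2)[of x] T[of x] x t by simp
      show "p x / w x \<le> 0" using neg[OF x(1)] by (simp add: w_def divide_nonpos_nonneg)
    qed
    have "\<forall>\<^sub>F b in at_top. g b > g t" using g by (simp add: filterlim_at_top_dense)
    then have "\<forall>\<^sub>F b :: real in at_top. False"
      using eventually_ge_at_top[of t]
    proof eventually_elim
      case (elim b)
      then show ?case using le[of b] by linarith
    qed
    then show False by simp
  qed
  have "1 / 2 \<le> deriv g t \<and> 1 - 4 / (g t)\<^sup>2 \<le> deriv g t" if t: "t \<ge> T" for t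
  proof -
    have w2: "(w t)\<^sup>2 = 1 + (p t)\<^sup>2" by (simp add: w_def add_nonneg_nonneg)
    have wp: "w t > 0" using w_large(2)[OF t] by linarith
    define x where "x = p t / w t"
    have x0: "x > 0" using p_pos[OF t] wp by (simp add: x_def)
    have x2: "x\<^sup>2 = 1 - 1 / (w t)\<^sup>2"
      using wp by (simp add: x_def power_divide w2[symmetric] field_simps)
    then have "x\<^sup>2 \<le> 1" by simp
    then have x1: "x \<le> 1" using x0 by (simp add: power_le_one_iff abs_square_le_1)
    then have "x\<^sup>2 \<le> x" using x0 by (simp add: power2_eq_square mult_left_le)
    then have low: "1 - 1 / (w t)\<^sup>2 \<le> x" using x2 by simp
    have "1 / (w t)\<^sup>2 \<le> 1 / (g t / 2)\<^sup>2"
      using w_large(1)[OF t] T[OF t] by (intro divide_left_mono power_mono mult_pos_pos) auto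
    moreover have "1 / (w t)\<^sup>2 \<le> 1 / 2\<^sup>2"
      using w_large(2)[OF t] by (intro divide_left_mono power_mono mult_pos_pos) auto
    ultimately show ?thesis
      using low T[OF t] dg[of t] by (simp add: x_def power_divide)
  qed
  then show ?thesis using that Ts by blast
qed

text \<open>The function \<open>t - g t\<close> is nondecreasing since \<open>g' < 1\<close>, and bounded since \<open>t - g t + 8 / g t\<close> is
  eventually nonincreasing: with \<open>g' \<ge> 1 / 2\<close> the last term decreases at rate at least
  \<open>4 / g\<^sup>2\<close>, which bounds \<open>1 - g'\<close>.\<close>

lemma unbounded_solution_drift:
  assumes d: "d \<ge> 1" and sol: "cmc_solution_on d {s<..} g" and g: "filterlim g at_top at_top"
  obtains c where "((\<lambda>t. g t - t) \<longlongrightarrow> c) at_top"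
proof -
  obtain T where Ts: "T > s" and T: "\<And>t. t \<ge> T \<Longrightarrow> 1 / 2 \<le> deriv g t \<and> 1 - 4 / (g t)\<^sup>2 \<le> deriv g t"
    using velocity_deficit[OF assms] by blast
  have pos: "g t > 0" and slow: "\<bar>deriv g t\<bar> < 1" and dg: "(g has_real_derivative deriv g t) (at t)"
    if "t \<ge> T" for t
  proof -
    have "t \<in> {s<..}" using that Ts by simp
    with sol show "g t > 0" "\<bar>deriv g t\<bar> < 1" "(g has_real_derivative deriv g t) (at t)"
      unfolding cmc_solution_on_def C2_on_def
      by (blast, blast, metis DERIV_deriv_iff_real_differentiable)
  qed
  \<comment> \<open>Constant before \<open>T\<close>, so as to be monotone on the whole line.\<close>
  define u where "u t = max t T - g (max t T)" for t
  have "mono u"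
  proof (rule monoI)
    fix x y :: real assume "x \<le> y"
    then have xy: "max x T \<le> max y T" by auto
    show "u x \<le> u y"
      unfolding u_def
    proof (rule DERIV_nonneg_imp_nondecreasing[OF xy], intro exI conjI)
      fix t assume "max x T \<le> t"
      then have t: "t \<ge> T" by simp
      show "((\<lambda>t. t - g t) has_real_derivative 1 - deriv g t) (at t)"
        by (auto intro!: derivative_eq_intros dg t)
      show "0 \<le> 1 - deriv g t" using slow[OF t] by simp
    qed
  qed
  moreover have "u t \<le> T - g T + 8 / g T" for t
  proof -
    let ?t = "max t T"
    have "?t - g ?t + 8 / g ?t \<le> T - g T + 8 / g T"
    proof (rule DERIV_nonpos_imp_nonincreasing[of T ?t], goal_cases)
      case (2 x)
      then have x: "x \<ge> T" by simp
      have "((\<lambda>t. t - g t + 8 / g t) has_real_derivative 1 - deriv g x - 8 * deriv g x / (g x)\<^sup>2) (at x)"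
        using pos[OF x] by (auto intro!: derivative_eq_intros dg x simp: power2_eq_square)
      moreover have "8 * (1 / 2) / (g x)\<^sup>2 \<le> 8 * deriv g x / (g x)\<^sup>2"
        using T[OF x] by (intro divide_right_mono mult_left_mono) auto
      then have "1 - deriv g x - 8 * deriv g x / (g x)\<^sup>2 \<le> 0"
        using T[OF x] by simp
      ultimately show ?case by blast
    qed simp
    moreover have "8 / g ?t \<ge> 0" using pos[of ?t] by simp
    ultimately show ?thesis unfolding u_def by linarith
  qed
  moreover from \<open>mono u\<close> have "incseq (\<lambda>n. u (real n))" by (simp add: mono_def)
  ultimately obtain L where "(\<lambda>n. u (real n)) \<longlonglongrightarrow> L"
    using incseq_convergent[of "\<lambda>n. u (real n)" "T - g T + 8 / g T"] by blast
  with \<open>mono u\<close> have "(u \<longlongrightarrow> L) at_top" by (rule tendsto_at_topI_sequentially_real)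
  then have "((\<lambda>t. - u t) \<longlongrightarrow> - L) at_top" by (rule tendsto_minus)
  moreover have "\<forall>\<^sub>F t in at_top. - u t = g t - t"
    using eventually_ge_at_top[of T] by eventually_elim (simp add: u_def max_absorb1)
  ultimately have "((\<lambda>t. g t - t) \<longlongrightarrow> - L) at_top" by (rule Lim_transform_eventually)
  then show ?thesis using that by blast
qed

section \<open>Instability and stability modulo translation\<close>

lemma deriv_shift: "deriv (\<lambda>t. f (t + \<tau>)) t = deriv f (t + \<tau>)" for f :: "real \<Rightarrow> real"
  by (simp add: deriv_def DERIV_shift)

lemma cmc_solution_shift:
  assumes "cmc_solution_on d {s<..} f"
  shows "cmc_solution_on d {s - \<tau><..} (\<lambda>t. f (t + \<tau>))"
proof -
  have eq: "deriv (\<lambda>t. f (t + \<tau>)) = (\<lambda>t. deriv f (t + \<tau>))"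
    "deriv (\<lambda>t. deriv f (t + \<tau>)) = (\<lambda>t. deriv (deriv f) (t + \<tau>))"
    by (rule ext, rule deriv_shift)+
  have diff: "(\<lambda>t. h (t + \<tau>)) differentiable (at t)" if "h differentiable (at (t + \<tau>))"
    for h :: "real \<Rightarrow> real" and t
    using that by (simp add: real_differentiable_def DERIV_shift)
  have "continuous_on {s - \<tau><..} (\<lambda>t. deriv (deriv f) (t + \<tau>))"
    using assms unfolding cmc_solution_on_def C2_on_def
    by (auto intro!: continuous_on_compose2[of "{s<..}" "deriv (deriv f)"] continuous_intros)
  then have "C2_on {s - \<tau><..} (\<lambda>t. f (t + \<tau>))"
    using assms unfolding cmc_solution_on_def C2_on_def eq by (auto intro!: diff)
  then show ?thesis
    using assms unfolding cmc_solution_on_def eq by auto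
qed

text \<open>The difference \<open>g t - f (t + \<tau>)\<close> tends to \<open>a - c - \<tau>\<close>.\<close>

lemma asymptotic_shift_iff:
  assumes g: "((\<lambda>t. g t - t) \<longlongrightarrow> a) at_top" and f: "((\<lambda>t. f t - t) \<longlongrightarrow> c) at_top"
  shows "asymptotic g (\<lambda>t. f (t + \<tau>)) \<longleftrightarrow> a = c + \<tau>"
proof -
  have "filterlim (\<lambda>t. \<tau> + t) at_top at_top"
    by (rule filterlim_tendsto_add_at_top[OF tendsto_const filterlim_ident])
  from filterlim_compose[OF f this] have "((\<lambda>t. f (t + \<tau>) - (t + \<tau>)) \<longlongrightarrow> c) at_top"
    by (simp add: add.commute)
  from tendsto_diff[OF g this] have "((\<lambda>t. g t - f (t + \<tau>) + \<tau>) \<longlongrightarrow> a - c) at_top"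
    by (simp add: algebra_simps)
  from tendsto_diff[OF this tendsto_const[of \<tau>]]
  have lim: "((\<lambda>t. g t - f (t + \<tau>)) \<longlongrightarrow> a - c - \<tau>) at_top" by simp
  have "asymptotic g (\<lambda>t. f (t + \<tau>)) \<longleftrightarrow> ((\<lambda>t. g t - f (t + \<tau>)) \<longlongrightarrow> 0) at_top"
    unfolding asymptotic_def by (rule tendsto_rabs_zero_iff)
  also have "\<dots> \<longleftrightarrow> a - c - \<tau> = 0"
    using lim tendsto_unique[OF trivial_limit_at_top_linorder lim] by metis
  finally show ?thesis by (simp add: algebra_simps)
qed

lemma drift_transfer:
  fixes g h :: "real \<Rightarrow> real"
  assumes "((\<lambda>t. g t - t) \<longlongrightarrow> a) at_top" and "\<And>t. t \<ge> t\<^sub>0 \<Longrightarrow> g t = h t"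
  shows "((\<lambda>t. h t - t) \<longlongrightarrow> a) at_top"
  by (rule Lim_transform_eventually[OF assms(1)])
    (use assms(2) in \<open>auto intro: eventually_mono[OF eventually_ge_at_top[of t\<^sub>0]]\<close>)

text \<open>The perturbed data are those of \<open>f\<close> itself a little later. They generate the translate
  \<open>f (t + \<epsilon>)\<close>, whose drift exceeds that of \<open>f\<close> by \<open>\<epsilon>\<close>.\<close>

lemma unstable_individually:
  assumes d: "d \<ge> 1" and sol: "cmc_solution_on d {0<..} f" and f: "filterlim f at_top at_top"
    and t0: "t\<^sub>0 > 0" and U: "open U" "(f t\<^sub>0, deriv f t\<^sub>0) \<in> U"
  shows "\<exists>p \<in> U \<inter> admissible_data. (\<exists>g. future_solution d t\<^sub>0 p g) \<and>
    (\<forall>g. future_solution d t\<^sub>0 p g \<longrightarrow> \<not> asymptotic g f)"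
proof -
  have diff: "f differentiable (at t\<^sub>0)" "deriv f differentiable (at t\<^sub>0)"
    using sol t0 by (auto simp: cmc_solution_on_def C2_on_def)
  have "isCont (\<lambda>t. (f t, deriv f t)) t\<^sub>0"
    using diff by (intro isCont_Pair differentiable_imp_continuous_within)
  then have "\<forall>\<^sub>F t in at t\<^sub>0. (f t, deriv f t) \<in> U"
    using U by (auto simp: isCont_def intro: topological_tendstoD)
  then obtain e where e: "e > 0" "\<And>t. t \<noteq> t\<^sub>0 \<Longrightarrow> dist t t\<^sub>0 < e \<Longrightarrow> (f t, deriv f t) \<in> U"
    unfolding eventually_at by auto
  define \<epsilon> where "\<epsilon> = e / 2"
  have \<epsilon>: "\<epsilon> > 0" using e(1) by (simp add: \<epsilon>_def)
  define p where "p = (f (t\<^sub>0 + \<epsilon>), deriv f (t\<^sub>0 + \<epsilon>))"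
  have "p \<in> U" unfolding p_def by (rule e(2)) (use e(1) in \<open>simp_all add: \<epsilon>_def dist_real_def\<close>)
  moreover have "p \<in> admissible_data"
    using sol t0 \<epsilon> by (auto simp: p_def admissible_data_def cmc_solution_on_def abs_less_iff minus_less_iff)
  moreover have fs: "future_solution d t\<^sub>0 p (\<lambda>t. f (t + \<epsilon>))"
    unfolding future_solution_def p_def deriv_shift
    using cmc_solution_shift[OF sol, of \<epsilon>] t0 \<epsilon> by (intro conjI exI[of _ "0 - \<epsilon>"]) auto
  moreover have "\<not> asymptotic g f" if g: "future_solution d t\<^sub>0 p g" for g
  proof
    obtain c where c: "((\<lambda>t. f t - t) \<longlongrightarrow> c) at_top" by (rule unbounded_solution_drift[OF d sol f])
    assume "asymptotic g f"
    moreover have "asymptotic g (\<lambda>t. f (t + \<epsilon>))"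
    proof -
      have "\<forall>\<^sub>F t in at_top. \<bar>g t - f (t + \<epsilon>)\<bar> = 0"
        using eventually_ge_at_top[of t\<^sub>0]
        by eventually_elim (simp add: future_solution_unique[OF d g fs])
      then show ?thesis unfolding asymptotic_def by (rule tendsto_eventually)
    qed
    moreover have "((\<lambda>t. g t - t) \<longlongrightarrow> c + \<epsilon>) at_top"
    proof -
      have "filterlim (\<lambda>t. \<epsilon> + t) at_top at_top"
        by (rule filterlim_tendsto_add_at_top[OF tendsto_const filterlim_ident])
      from filterlim_compose[OF c this]
      have "((\<lambda>t. f (t + \<epsilon>) - (t + \<epsilon>) + \<epsilon>) \<longlongrightarrow> c + \<epsilon>) at_top"
        by (intro tendsto_add tendsto_const) (simp add: add.commute)
      then have "((\<lambda>t. f (t + \<epsilon>) - t) \<longlongrightarrow> c + \<epsilon>) at_top" by simp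
      then show ?thesis by (rule drift_transfer) (rule future_solution_unique[OF d fs g])
    qed
    ultimately have "c + \<epsilon> = c + 0"
      using asymptotic_shift_iff[of g "c + \<epsilon>" f c 0] c by simp
    then show False using \<epsilon> by simp
  qed
  ultimately show ?thesis by blast
qed

text \<open>All data near those of \<open>f\<close> are escaping and so generate an unbounded solution; the required translation
  is the difference of the drifts.\<close>

lemma stable_modulo_translation:
  assumes d: "d \<ge> 1" and sol: "cmc_solution_on d {0<..} f" and f: "filterlim f at_top at_top"
    and t0: "t\<^sub>0 > 0"
  shows "\<exists>U. open U \<and> (f t\<^sub>0, deriv f t\<^sub>0) \<in> U \<and>
    (\<forall>p \<in> U \<inter> admissible_data. (\<exists>g. future_solution d t\<^sub>0 p g) \<and>
      (\<exists>\<tau>\<^sub>0. \<forall>g. future_solution d t\<^sub>0 p g \<longrightarrow> asymptotic g (\<lambda>t. f (t + \<tau>\<^sub>0))))"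
proof -
  obtain c where c: "((\<lambda>t. f t - t) \<longlongrightarrow> c) at_top" by (rule unbounded_solution_drift[OF d sol f])
  have "f t\<^sub>0 > 0" "\<bar>deriv f t\<^sub>0\<bar> < 1" using sol t0 by (auto simp: cmc_solution_on_def)
  from eventually_escaping[OF this unbounded_solution_escaping[OF d sol t0 f]]
  obtain U where U: "open U" "(f t\<^sub>0, deriv f t\<^sub>0) \<in> U" "\<And>q. q \<in> U \<Longrightarrow> escaping d (fst q) (snd q)"
    unfolding eventually_nhds by blast
  have "(\<exists>g. future_solution d t\<^sub>0 p g) \<and>
      (\<exists>\<tau>\<^sub>0. \<forall>g. future_solution d t\<^sub>0 p g \<longrightarrow> asymptotic g (\<lambda>t. f (t + \<tau>\<^sub>0)))"
    if p: "p \<in> U \<inter> admissible_data" for p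
  proof -
    obtain a v where pav: "p = (a, v)" by (cases p)
    have "a > 0" "\<bar>v\<bar> < 1" "escaping d a v"
      using p U(3)[of p] by (auto simp: pav admissible_data_def)
    then obtain g where g: "future_solution d t\<^sub>0 p g" "filterlim g at_top at_top"
      unfolding pav by (rule escaping_imp_future_solution)
    obtain s where "cmc_solution_on d {s<..} g" using g(1) unfolding future_solution_def by blast
    then obtain b where b: "((\<lambda>t. g t - t) \<longlongrightarrow> b) at_top"
      by (rule unbounded_solution_drift[OF d _ g(2)])
    have "asymptotic h (\<lambda>t. f (t + (b - c)))" if h: "future_solution d t\<^sub>0 p h" for h
    proof -
      have "((\<lambda>t. h t - t) \<longlongrightarrow> b) at_top"
        by (rule drift_transfer[OF b]) (rule future_solution_unique[OF d g(1) h])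
      from asymptotic_shift_iff[OF this c] show ?thesis by simp
    qed
    then show ?thesis using g(1) by blast
  qed
  with U show ?thesis by blast
qed

theorem theorem1p3:
  fixes d :: nat and f :: "real \<Rightarrow> real" and t\<^sub>0 :: real
    and M :: "'n::finite spacetime set"
  assumes "d \<ge> 1" and "CARD('n) = d + 1"
    and "\<And>t. t > 0 \<Longrightarrow> f t > 0" and "C2_on {0<..} f"
    and "M = spherical_hypersurface f"
    and "filterlim f at_top at_top"
    and "t\<^sub>0 > 0"
  shows "(timelike_cmc_hypersurface (real (d + 1)) M \<longleftrightarrow> cmc_solution_on d {0<..} f) \<and>
    (timelike_cmc_hypersurface (real (d + 1)) M \<longrightarrow>
      (\<forall>U. open U \<and> (f t\<^sub>0, deriv f t\<^sub>0) \<in> U \<longrightarrow>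
         (\<exists>p \<in> U \<inter> admissible_data.
            (\<exists>g. future_solution d t\<^sub>0 p g) \<and>
            (\<forall>g. future_solution d t\<^sub>0 p g \<longrightarrow> \<not> asymptotic g f))) \<and>
      (\<exists>U. open U \<and> (f t\<^sub>0, deriv f t\<^sub>0) \<in> U \<and>
         (\<forall>p \<in> U \<inter> admissible_data.
            (\<exists>g. future_solution d t\<^sub>0 p g) \<and>
            (\<exists>\<tau>\<^sub>0. \<forall>g. future_solution d t\<^sub>0 p g \<longrightarrow> asymptotic g (\<lambda>t. f (t + \<tau>\<^sub>0))))))"
proof -
  have iff: "timelike_cmc_hypersurface (real (d + 1)) M \<longleftrightarrow> cmc_solution_on d {0<..} f"
    unfolding assms(5) using timelike_cmc_spherical_iff[OF assms(3,4,2)] by blast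
  show ?thesis
    unfolding iff
    using unstable_individually[OF assms(1) _ assms(6,7)] stable_modulo_translation[OF assms(1) _ assms(6,7)]
    by blast
qed

end
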